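(* There exists $\varepsilon_0>0$ such that for any $\varepsilon\in(0,\varepsilon_0)$, any positive integer $n$, and any convex body $C\subset\mathbb{R}^n$ that is symmetric around the origin, there is a generalized ellipsoid $\mathcal{E}_d\subset\mathbb{R}^n$ of degree $d$, centered at the origin, with $$d\le 2\left(\frac{1}{2\sqrt{\varepsilon}}\log\left(\frac1\varepsilon\right)\right)^n-3,$$ satisfying $$\mathcal{E}_d\subseteq C\subseteq(1+\varepsilon)\mathcal{E}_d.$$
   Context: A convex body is a compact convex set with nonempty interior. $\log$ is the natural logarithm. For $\lambda>0$, $\lambda\mathcal{E}_d=\{\lambda x\mid x\in\mathcal{E}_d\}$. A set $\mathcal{E}_d\subset\mathbb{R}^n$ is a generalized ellipsoid of degree $d$ ($d$ a nonnegative integer) centered at the origin if it can be written as $\mathcal{E}_d=\{x\in\mathbb{R}^n\mid x^TP(t)x\le 1\ \ \forall t\in[-1,1]\}$ for some univariate polynomial matrix $P(t)$ (a real symmetric $n\times n$ matrix whose entries are polynomials in $t$) of degree at most $d$ that satisfies $P(t)\succeq 0$ for all $t\in[-1,1]$ and $\bigcap_{t\in[-1,1]}\mathrm{Ker}(P(t))=\{0\}$. *)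

theory Defs
  imports
    "HOL-Analysis.Analysis"
    "HOL-Computational_Algebra.Polynomial"
begin

text \<open>
  The constant \<open>\<epsilon>\<^sub>0\<close> of the theorem must not depend on the dimension, so the dimension \<open>n\<close> has
  to be a natural number bound inside the statement rather than a type. The space \<open>\<real>\<^sup>n\<close> is
  the library topology \<^const>\<open>Euclidean_space\<close> \<open>n\<close>; its points are the functions
  \<open>x :: nat \<Rightarrow> real\<close> with \<open>x i = 0\<close> for all \<open>i \<ge> n\<close>. The library does not make
  \<open>nat \<Rightarrow> real\<close> a \<^class>\<open>real_vector\<close>, hence the pointwise operations.
\<close>

definition convex_body :: "nat \<Rightarrow> (nat \<Rightarrow> real) set \<Rightarrow> bool" where
  "convex_body n C \<longleftrightarrow>
     compactin (Euclidean_space n) C \<and>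
     (\<forall>x\<in>C. \<forall>y\<in>C. \<forall>u\<ge>0. \<forall>v\<ge>0. u + v = 1 \<longrightarrow> (\<lambda>i. u * x i + v * y i) \<in> C) \<and>
     Euclidean_space n interior_of C \<noteq> {}"

definition origin_symmetric :: "(nat \<Rightarrow> real) set \<Rightarrow> bool" where
  "origin_symmetric C \<longleftrightarrow> (\<forall>x\<in>C. (\<lambda>i. - x i) \<in> C)"

definition dilate :: "real \<Rightarrow> (nat \<Rightarrow> real) set \<Rightarrow> (nat \<Rightarrow> real) set" where
  "dilate c E = {\<lambda>i. c * x i |x. x \<in> E}"

text \<open>
  Only the entries \<open>P i j\<close> with \<open>i < n\<close> and \<open>j < n\<close> of a polynomial matrix are relevant.
\<close>

definition quad_form :: "nat \<Rightarrow> (nat \<Rightarrow> nat \<Rightarrow> real) \<Rightarrow> (nat \<Rightarrow> real) \<Rightarrow> real" where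
  "quad_form n A x = (\<Sum>i<n. \<Sum>j<n. x i * A i j * x j)"

definition mat_kernel :: "nat \<Rightarrow> (nat \<Rightarrow> nat \<Rightarrow> real) \<Rightarrow> (nat \<Rightarrow> real) set" where
  "mat_kernel n A =
     {x \<in> topspace (Euclidean_space n). \<forall>i<n. (\<Sum>j<n. A i j * x j) = 0}"

definition poly_mat_eval :: "(nat \<Rightarrow> nat \<Rightarrow> real poly) \<Rightarrow> real \<Rightarrow> nat \<Rightarrow> nat \<Rightarrow> real" where
  "poly_mat_eval P t = (\<lambda>i j. poly (P i j) t)"

definition generalized_ellipsoid :: "nat \<Rightarrow> nat \<Rightarrow> (nat \<Rightarrow> real) set \<Rightarrow> bool" where
  "generalized_ellipsoid n d E \<longleftrightarrow>
     (\<exists>P :: nat \<Rightarrow> nat \<Rightarrow> real poly.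
        (\<forall>i<n. \<forall>j<n. P i j = P j i \<and> degree (P i j) \<le> d) \<and>
        (\<forall>t\<in>{-1..1}. \<forall>x \<in> topspace (Euclidean_space n). quad_form n (poly_mat_eval P t) x \<ge> 0) \<and>
        (\<Inter>t\<in>{-1..1}. mat_kernel n (poly_mat_eval P t)) = {\<lambda>i. 0} \<and>
        E = {x \<in> topspace (Euclidean_space n).
               \<forall>t\<in>{-1..1}. quad_form n (poly_mat_eval P t) x \<le> 1})"

end

theory Submission
  imports
    Defs
    "HOL-Real_Asymp.Real_Asymp"
    "Jordan_Normal_Form.Determinant"
begin

text \<open>
  The proof approximates \<open>C\<close> by a symmetric polytope with few facets and then writes that
  polytope, exactly, as a generalized ellipsoid.

  Few facets, following Barvinok's idea of testing with high powers of linear forms. Let \<open>B\<close> be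
  the polar of \<open>C\<close>. The polynomials of degree at most \<open>k\<close> on \<open>B\<close> form a space spanned by
  \<open>D = (n + k) choose k\<close> functions. Among all \<open>2 * D\<close>-tuples of points of \<open>B\<close> take one that
  maximizes the determinant of the Gram matrix of these functions, with a small multiple of the
  identity added. Since exchanging one point for another cannot increase the determinant, in the
  limit of a vanishing multiple every polynomial \<open>p\<close> of the space satisfies
  \<open>p(b)\<^sup>2 \<le> \<Sum>i<2 * D. p(b\<^sub>i)\<^sup>2\<close> on \<open>B\<close> (lemma \<open>sampling_inequality\<close>).
  Apply this to \<open>p(b) = T\<^sub>k(b \<bullet> x)\<close> with the Chebyshev polynomial \<open>T\<^sub>k\<close>: if
  \<open>\<bar>b\<^sub>i \<bullet> x\<bar> \<le> 1\<close> at all sample points, then \<open>T\<^sub>k(b \<bullet> x)\<^sup>2 \<le> 2 * D\<close> for every \<open>b\<close> in \<open>B\<close>, and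
  the exponential growth of \<open>T\<^sub>k\<close> to the right of \<open>1\<close> forces \<open>b \<bullet> x \<le> 1 + \<epsilon>\<close> once \<open>k\<close> is
  so large that \<open>2 * D\<close> is below \<open>((1 + sqrt (2 * \<epsilon>)) ^ k / 2)\<^sup>2\<close>
  (lemma \<open>polytope_approximation\<close>). So the strips \<open>\<bar>b\<^sub>i \<bullet> x\<bar> \<le> 1\<close> cut out a polytope between \<open>C\<close> and \<open>(1 + \<epsilon>) C\<close>.

  The sampling inequality loses only the square root of the dimension, and this is what makes the
  constant \<open>1 / 2\<close> of the bound attainable: the condition asks for
  \<open>k * sqrt (2 * \<epsilon>)\<close> to be about \<open>ln D / 2\<close>, which gives \<open>k\<close> about
  \<open>n * ln (1 / \<epsilon>) / (4 * sqrt (2 * \<epsilon>))\<close> and hence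
  \<open>D\<close> at most about \<open>(e * k / n) ^ n = (e / (4 * sqrt 2) * ln (1 / \<epsilon>) / sqrt \<epsilon>) ^ n\<close>, and
  \<open>e / (4 * sqrt 2) < 1 / 2\<close> (lemma \<open>degree_choice\<close>).

  Polytope as generalized ellipsoid. For \<open>m\<close> strips \<open>\<bar>a\<^sub>l \<bullet> x\<bar> \<le> 1\<close> put
  \<open>P(t) = \<Sum>l<m. h\<^sub>l(t) a\<^sub>l a\<^sub>l\<^sup>T\<close>, where the \<open>h\<^sub>l\<close> are polynomials of degree at most
  \<open>2 * m - 1\<close> that are nonnegative on \<open>[-1,1]\<close>, add up to \<open>1\<close>, and reach \<open>1\<close> at a node each.
  Then \<open>x\<^sup>T P(t) x\<close> is a convex combination of the numbers \<open>(a\<^sub>l \<bullet> x)\<^sup>2\<close> that attains each of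
  them, so it stays below \<open>1\<close> for all \<open>t\<close> exactly when \<open>x\<close> lies in all strips
  (lemma \<open>polytope_as_generalized_ellipsoid\<close>). The \<open>h\<^sub>l\<close> come from the Fejer kernel.
  With \<open>m = 2 * D\<close> the degree is \<open>4 * D - 1\<close>, so the bound of the theorem amounts to
  \<open>2 * D \<le> (ln (1 / \<epsilon>) / (2 * sqrt \<epsilon>)) ^ n - 1\<close>.
\<close>

section \<open>Chebyshev polynomials\<close>

fun cheb_poly :: "nat \<Rightarrow> real poly" where
  "cheb_poly 0 = 1"
| "cheb_poly (Suc 0) = [:0, 1:]"
| "cheb_poly (Suc (Suc k)) = [:0, 2:] * cheb_poly (Suc k) - cheb_poly k"

lemma degree_cheb_poly: "degree (cheb_poly k) \<le> k"
proof (induction k rule: cheb_poly.induct)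
  case (3 k)
  have "degree ([:0, 2:] * cheb_poly (Suc k)) \<le> Suc (Suc k)"
    using degree_mult_le[of "[:0, 2:]" "cheb_poly (Suc k)"] 3 by simp
  moreover have "degree (cheb_poly k) \<le> Suc (Suc k)" using 3 by simp
  ultimately show ?case by (simp only: cheb_poly.simps degree_diff_le)
qed auto

lemma poly_cheb_cos: "poly (cheb_poly k) (cos \<theta>) = cos (real k * \<theta>)"
proof (induction k rule: cheb_poly.induct)
  case (3 k)
  have "cos (real (Suc (Suc k)) * \<theta>) + cos (real k * \<theta>) = 2 * cos \<theta> * cos (real (Suc k) * \<theta>)"
    using cos_add[of "real (Suc k) * \<theta>" \<theta>] cos_diff[of "real (Suc k) * \<theta>" \<theta>] by (simp add: algebra_simps)
  then show ?case using 3 by simp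
qed auto

text \<open>
  In the coordinate \<open>z\<close> with \<open>y = (z + 1 / z) / 2\<close>, the continuation of \<open>y = cos \<theta>\<close> beyond
  \<open>[-1,1]\<close>, the Chebyshev polynomial is visibly exponential in its degree.
\<close>

lemma poly_cheb_joukowski:
  assumes "z \<noteq> 0"
  shows "poly (cheb_poly k) ((z + 1 / z) / 2) = (z ^ k + 1 / z ^ k) / 2"
proof (induction k rule: cheb_poly.induct)
  case (3 k)
  define w where "w = 1 / z"
  have zw: "z * w = 1" and wk: "1 / z ^ j = w ^ j" for j
    using assms unfolding w_def by (auto simp: power_one_over)
  have "(z + w) * (z ^ Suc k + w ^ Suc k) = z ^ Suc (Suc k) + w ^ Suc (Suc k) + z * w * (z ^ k + w ^ k)"
    by (simp add: algebra_simps)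
  then show ?case using 3 unfolding wk w_def[symmetric] zw by (simp add: field_simps)
qed auto

text \<open>
  The larger root \<open>z\<close> of \<open>y = (z + 1 / z) / 2\<close> is
  \<open>y + sqrt (y\<^sup>2 - 1)\<close>, whose second summand is at least \<open>s\<close>. Later \<open>s = sqrt (2 * \<epsilon>)\<close>.
\<close>

lemma poly_cheb_ge:
  assumes "0 \<le> s" "1 + s\<^sup>2 / 2 \<le> y"
  shows "(1 + s) ^ k / 2 \<le> poly (cheb_poly k) y"
proof -
  define r where "r = sqrt (y\<^sup>2 - 1)"
  have y1: "y \<ge> 1" using assms by (smt (verit) zero_le_power2 divide_nonneg_nonneg)
  then have r2: "r\<^sup>2 = y\<^sup>2 - 1" unfolding r_def by simp
  have "s\<^sup>2 \<le> r\<^sup>2"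
  proof -
    have "(1 + s\<^sup>2 / 2)\<^sup>2 \<le> y\<^sup>2" using assms by (intro power_mono) auto
    moreover have "(1 + s\<^sup>2 / 2)\<^sup>2 = 1 + s\<^sup>2 + (s\<^sup>2 / 2)\<^sup>2" by (simp add: power2_eq_square field_simps)
    ultimately show ?thesis using r2 zero_le_power2[of "s\<^sup>2 / 2"] by linarith
  qed
  moreover have "r \<ge> 0" unfolding r_def using y1 by simp
  ultimately have sr: "s \<le> r" using power2_le_imp_le by blast
  define z where "z = y + r"
  have z: "1 + s \<le> z" "z \<ge> 1" "z \<noteq> 0" using sr y1 assms unfolding z_def by auto
  have "z * (y - r) = 1" unfolding z_def using r2 by (simp add: algebra_simps power2_eq_square)
  then have "1 / z = y - r" using z by (simp add: field_simps)
  then have "y = (z + 1 / z) / 2" unfolding z_def by simp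
  then have "poly (cheb_poly k) y = (z ^ k + 1 / z ^ k) / 2" using poly_cheb_joukowski z by metis
  moreover have "(1 + s) ^ k \<le> z ^ k" using z assms by (intro power_mono) auto
  moreover have "0 \<le> 1 / z ^ k" using z by simp
  ultimately show ?thesis by (smt (verit) divide_right_mono)
qed

lemma cheb_poly_abs_le_1:
  assumes "\<bar>y\<bar> \<le> 1" shows "\<bar>poly (cheb_poly k) y\<bar> \<le> 1"
  by (metis abs_cos_le_one assms cos_arccos_abs poly_cheb_cos)

section \<open>A Fejer partition of unity\<close>

text \<open>
  With \<open>F\<close> the Fejer kernel normalized by \<open>F(0) = 1\<close> and
  \<open>\<theta>\<^sub>j = (2 * j + 1) * pi / (2 * m)\<close>, this is \<open>F(\<theta> - \<theta>\<^sub>j) + F(\<theta> + \<theta>\<^sub>j)\<close> as a polynomial in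
  \<open>cos \<theta>\<close>: the symmetrization leaves only cosines, and \<open>cos (r * \<theta>)\<close> is a Chebyshev polynomial.
  The kernel of order \<open>2 * m\<close> has degree \<open>2 * m - 1\<close>.
\<close>

definition fejer_poly :: "nat \<Rightarrow> nat \<Rightarrow> real poly" where
  "fejer_poly m j = Polynomial.smult (2 / (real (2 * m))\<^sup>2)
     (\<Sum>a<2*m. \<Sum>b<2*m. Polynomial.smult (cos ((real a - real b) * (real (2 * j + 1) * pi / real (2 * m))))
        (cheb_poly (nat \<bar>int a - int b\<bar>)))"

text \<open>
  The reason why the Fejer kernel is nonnegative: it is the squared modulus of a sum of
  exponentials.
\<close>

lemma sum_sum_cos:
  "(\<Sum>a<N. \<Sum>b<N. cos ((real a - real b) * \<phi>)) =
     (\<Sum>a<N. cos (real a * \<phi>))\<^sup>2 + (\<Sum>a<N. sin (real a * \<phi>))\<^sup>2"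
  by (simp add: power2_eq_square sum_product cos_diff left_diff_distrib sum.distrib)

lemma poly_fejer:
  assumes "t = cos \<theta>"
  shows "poly (fejer_poly m j) t = 1 / (real (2 * m))\<^sup>2 *
     ((\<Sum>a<2*m. \<Sum>b<2*m. cos ((real a - real b) * (\<theta> - real (2 * j + 1) * pi / real (2 * m))))
    + (\<Sum>a<2*m. \<Sum>b<2*m. cos ((real a - real b) * (\<theta> + real (2 * j + 1) * pi / real (2 * m)))))"
proof -
  have T: "poly (cheb_poly (nat \<bar>int a - int b\<bar>)) t = cos ((real a - real b) * \<theta>)" for a b
  proof (cases "a \<ge> b")
    case True
    then show ?thesis using poly_cheb_cos[of "a - b" \<theta>] assms by (simp add: nat_diff_distrib of_nat_diff)
  next
    case False
    have "cos ((real a - real b) * \<theta>) = cos (real (b - a) * \<theta>)"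
      using False cos_minus[of "(real a - real b) * \<theta>"] by (simp add: of_nat_diff algebra_simps)
    then show ?thesis using False poly_cheb_cos[of "b - a" \<theta>] assms by (simp add: nat_diff_distrib of_nat_diff)
  qed
  define w where "w = real (2 * j + 1) * pi / real (2 * m)"
  have E: "2 * (cos (x * w) * cos (x * \<theta>)) = cos (x * (\<theta> - w)) + cos (x * (\<theta> + w))" for x
    by (simp add: distrib_left right_diff_distrib cos_add cos_diff)
  have "poly (fejer_poly m j) t = 1 / (real (2 * m))\<^sup>2 *
      (\<Sum>a<2*m. \<Sum>b<2*m. 2 * (cos ((real a - real b) * w) * cos ((real a - real b) * \<theta>)))"
    unfolding fejer_poly_def w_def[symmetric] by (simp add: poly_sum T sum_distrib_left mult.commute)
  then show ?thesis unfolding E w_def[symmetric] by (simp add: sum.distrib mult.commute)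
qed

lemma fejer_nonneg:
  assumes "\<bar>t\<bar> \<le> 1"
  shows "0 \<le> poly (fejer_poly m j) t"
proof -
  have "t = cos (arccos t)" using assms by (simp add: cos_arccos_abs)
  from poly_fejer[OF this, of m j] show ?thesis unfolding sum_sum_cos by simp
qed

text \<open>
  One of the two summands is \<open>F(0) = 1\<close>, the other one is nonnegative. Together with
  \<open>sum_fejer\<close> this already makes the value exactly \<open>1\<close> and all other members vanish there.
\<close>

lemma fejer_node_ge_1:
  assumes "m > 0"
  shows "1 \<le> poly (fejer_poly m j) (cos (real (2 * j + 1) * pi / real (2 * m)))"
proof -
  define w where "w = real (2 * j + 1) * pi / real (2 * m)"
  have "0 \<le> (\<Sum>a<2*m. \<Sum>b<2*m. cos ((real a - real b) * (w + w)))" unfolding sum_sum_cos by simp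
  moreover have "(\<Sum>a<2*m. \<Sum>b<2*m. cos ((real a - real b) * (w - w))) = (real (2 * m))\<^sup>2"
    by (simp add: power2_eq_square)
  ultimately have "1 / (real (2 * m))\<^sup>2 * (real (2 * m))\<^sup>2 \<le> poly (fejer_poly m j) (cos w)"
    using poly_fejer[OF refl, of m j w] unfolding w_def[symmetric]
    by (metis (no_types, lifting) le_add_same_cancel1 mult_left_mono zero_le_divide_1_iff zero_le_power2)
  then show ?thesis using assms unfolding w_def by simp
qed

text \<open>
  Multiplication by \<open>2 * sin \<alpha>\<close> makes the sum telescope to \<open>sin (2 * m * \<alpha>)\<close>, and
  \<open>2 * m * \<alpha>\<close> is a multiple of \<open>pi\<close>.
\<close>

lemma sum_cos_odd_multiples:
  assumes "0 < r" "r < 2 * m"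
  shows "(\<Sum>j<m. cos (real r * (real (2 * j + 1) * pi / real (2 * m)))) = 0"
proof -
  define \<alpha> where "\<alpha> = real r * pi / real (2 * m)"
  have tel: "2 * sin \<alpha> * (\<Sum>j<k. cos (real (2 * j + 1) * \<alpha>)) = sin (real (2 * k) * \<alpha>)" for k
  proof (induction k)
    case (Suc k)
    have a: "sin (real (2 * Suc k) * \<alpha>) - sin (real (2 * k) * \<alpha>) = 2 * sin \<alpha> * cos (real (2 * k + 1) * \<alpha>)"
      using sin_add[of "real (2 * k + 1) * \<alpha>" \<alpha>] sin_diff[of "real (2 * k + 1) * \<alpha>" \<alpha>]
      by (simp add: algebra_simps)
    then show ?case using Suc by (simp add: distrib_left)
  qed simp
  have "0 < \<alpha>" unfolding \<alpha>_def using assms by simp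
  moreover have "\<alpha> < pi" unfolding \<alpha>_def using assms by (simp add: field_simps)
  ultimately have "sin \<alpha> \<noteq> 0" using sin_gt_zero by fastforce
  moreover have "real (2 * m) * \<alpha> = real r * pi" unfolding \<alpha>_def using assms by simp
  then have "sin (real (2 * m) * \<alpha>) = 0" by simp
  ultimately have "(\<Sum>j<m. cos (real (2 * j + 1) * \<alpha>)) = 0" using tel[of m] by simp
  then show ?thesis unfolding \<alpha>_def by (simp add: mult_ac)
qed

text \<open>
  Summation over the nodes kills all frequencies \<open>a - b\<close> except zero.
\<close>

lemma sum_fejer:
  assumes "m > 0"
  shows "(\<Sum>j<m. poly (fejer_poly m j) t) = 1"
proof -
  define w where "w j = real (2 * j + 1) * pi / real (2 * m)" for j
  have S: "(\<Sum>j<m. cos ((real a - real b) * w j)) = (if a = b then real m else 0)"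
    if "a < 2 * m" "b < 2 * m" for a b
  proof (cases a b rule: linorder_cases)
    case less
    have "cos ((real a - real b) * w j) = cos (real (b - a) * w j)" for j
      using less cos_minus[of "(real a - real b) * w j"] by (simp add: of_nat_diff algebra_simps)
    then show ?thesis using sum_cos_odd_multiples[of "b - a" m] that less unfolding w_def by simp
  next
    case greater
    then show ?thesis using sum_cos_odd_multiples[of "a - b" m] that unfolding w_def
      by (simp add: of_nat_diff)
  qed auto
  have "(\<Sum>j<m. poly (fejer_poly m j) t) = 2 / (real (2 * m))\<^sup>2 *
     (\<Sum>j<m. \<Sum>a<2*m. \<Sum>b<2*m. cos ((real a - real b) * w j) * poly (cheb_poly (nat \<bar>int a - int b\<bar>)) t)"
    unfolding fejer_poly_def w_def[symmetric] by (simp add: poly_sum sum_distrib_left)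
  also have "(\<Sum>j<m. \<Sum>a<2*m. \<Sum>b<2*m. cos ((real a - real b) * w j) * poly (cheb_poly (nat \<bar>int a - int b\<bar>)) t)
     = (\<Sum>a<2*m. \<Sum>j<m. \<Sum>b<2*m. cos ((real a - real b) * w j) * poly (cheb_poly (nat \<bar>int a - int b\<bar>)) t)"
    by (rule sum.swap)
  also have "\<dots> = (\<Sum>a<2*m. \<Sum>b<2*m. \<Sum>j<m. cos ((real a - real b) * w j) * poly (cheb_poly (nat \<bar>int a - int b\<bar>)) t)"
    by (intro sum.cong refl sum.swap)
  also have "\<dots> = (\<Sum>a<2*m. \<Sum>b<2*m. (if a = b then real m else 0) * poly (cheb_poly (nat \<bar>int a - int b\<bar>)) t)"
    by (intro sum.cong refl) (simp add: sum_distrib_right[symmetric] S)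
  also have "\<dots> = (\<Sum>a<2*m. \<Sum>b<2*m. if b = a then real m else 0)"
    by (intro sum.cong refl) auto
  also have "\<dots> = 2 * (real m)\<^sup>2" by (simp add: power2_eq_square)
  finally show ?thesis using assms by (simp add: power2_eq_square field_simps)
qed

lemma degree_fejer_poly: "degree (fejer_poly m j) \<le> 2 * m - 1"
  unfolding fejer_poly_def
proof (intro order.trans[OF degree_smult_le] degree_sum_le finite_lessThan)
  fix a b assume "a \<in> {..<2*m}" "b \<in> {..<2*m}"
  then have "nat \<bar>int a - int b\<bar> \<le> 2 * m - 1" by auto
  then show "degree (cheb_poly (nat \<bar>int a - int b\<bar>)) \<le> 2 * m - 1"
    using degree_cheb_poly order.trans by blast
qed

section \<open>A determinant exchange formula\<close>

text \<open>
  Both determinants are that of the block matrix \<open>?E\<close>, cleared by the unipotent \<open>?U\<close> once from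
  the left and once from the right.
\<close>

lemma sylvester_det:
  fixes P Q :: "real mat"
  assumes P: "P \<in> carrier_mat n m" and Q: "Q \<in> carrier_mat m n"
  shows "det (1\<^sub>m n + P * Q) = det (1\<^sub>m m + Q * P)"
proof -
  let ?E = "four_block_mat (1\<^sub>m n) (- P) Q (1\<^sub>m m)"
  let ?U = "four_block_mat (1\<^sub>m n) P (0\<^sub>m m n) (1\<^sub>m m)"
  have car: "?E \<in> carrier_mat (n + m) (n + m)" "?U \<in> carrier_mat (n + m) (n + m)"
    using P Q by auto
  have U: "det ?U = 1"
    by (subst det_four_block_mat_lower_left_zero[of _ n _ m]) (use P in auto)
  have "det (?U * ?E) = det (1\<^sub>m n + P * Q)"
  proof -
    have "?U * ?E = four_block_mat (1\<^sub>m n + P * Q) (0\<^sub>m n m) Q (1\<^sub>m m)"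
      using P Q by (subst mult_four_block_mat[of _ n n _ m _ m _ _ n _ m]) auto
    then show ?thesis using P Q by (simp add: det_four_block_mat_upper_right_zero[of _ n _ m])
  qed
  moreover have "det (?E * ?U) = det (1\<^sub>m m + Q * P)"
  proof -
    have "?E * ?U = four_block_mat (1\<^sub>m n) (0\<^sub>m n m) Q (1\<^sub>m m + Q * P)"
      using P Q by (subst mult_four_block_mat[of _ n n _ m _ m _ _ n _ m]) (auto simp: comm_add_mat[of _ m m])
    then show ?thesis using P Q by (simp add: det_four_block_mat_upper_right_zero[of _ n _ m])
  qed
  ultimately show ?thesis using det_mult[OF car] det_mult[OF car(2) car(1)] U by simp
qed

lemma det_2x2:
  assumes A: "(A :: real mat) \<in> carrier_mat 2 2"
  shows "det A = A $$ (0,0) * A $$ (1,1) - A $$ (0,1) * A $$ (1,0)"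
proof -
  have "det (mat_delete A i 0) = mat_delete A i 0 $$ (0,0)" for i
    using A by (intro det_single) (auto simp: mat_delete_def)
  then show ?thesis
    using laplace_expansion_column[OF A, of 0] A
    by (simp add: numeral_2_eq_2 cofactor_def mat_delete_def)
qed

text \<open>
  The effect on a determinant of replacing \<open>v v\<^sup>T\<close> by \<open>w w\<^sup>T\<close>. The change has rank two, so after
  division by \<open>M\<close> it is a determinant of size two, in which only values of the quadratic form of
  \<open>M\<close>'s inverse occur.
\<close>

lemma det_exchange:
  fixes M N :: "real mat" and v w :: "nat \<Rightarrow> real"
  assumes M: "M \<in> carrier_mat D D" and N: "N \<in> carrier_mat D D" and MN: "M * N = 1\<^sub>m D"
    and q: "\<And>x y. q x y = (\<Sum>i<D. \<Sum>j<D. x i * N $$ (i,j) * y j)"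
  shows "det (mat D D (\<lambda>(i,j). M $$ (i,j) + w i * w j - v i * v j)) =
    det M * ((1 - q v v) * (1 + q w w) + q v w * q w v)"
proof -
  define S where "S = mat D 2 (\<lambda>(i,a). if a = 0 then - v i else w i)"
  define Q where "Q = mat 2 D (\<lambda>(a,j). if a = 0 then v j else w j)"
  have S: "S \<in> carrier_mat D 2" and Q: "Q \<in> carrier_mat 2 D" unfolding S_def Q_def by auto
  have NS: "N * S \<in> carrier_mat D 2" using N S by simp
  have "mat D D (\<lambda>(i,j). M $$ (i,j) + w i * w j - v i * v j) = M + S * Q"
    using M by (intro eq_matI) (auto simp: S_def Q_def scalar_prod_def numeral_2_eq_2)
  also have "S * Q = M * (N * S * Q)"
  proof -
    have "M * (N * S * Q) = (M * (N * S)) * Q" using M NS Q by (rule assoc_mult_mat[symmetric])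
    also have "M * (N * S) = (M * N) * S" using M N S by (rule assoc_mult_mat[symmetric])
    finally show ?thesis using MN S by simp
  qed
  also have "M + M * (N * S * Q) = M * (1\<^sub>m D + N * S * Q)"
    using M NS Q by (subst mult_add_distrib_mat[of _ D D _ D]) auto
  finally have "det (mat D D (\<lambda>(i,j). M $$ (i,j) + w i * w j - v i * v j)) = det M * det (1\<^sub>m 2 + Q * (N * S))"
    using det_mult[OF M, of "1\<^sub>m D + N * S * Q"] sylvester_det[OF NS Q] M NS Q by simp
  also have "det (1\<^sub>m 2 + Q * (N * S)) = (1 - q v v) * (1 + q w w) + q v w * q w v"
  proof -
    have e: "(Q * (N * S)) $$ (a,b) = (\<Sum>i<D. \<Sum>j<D. Q $$ (a,i) * N $$ (i,j) * S $$ (j,b))"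
      if "a < 2" "b < 2" for a b
      using that N S Q NS by (simp add: scalar_prod_def atLeast0LessThan sum_distrib_left mult.assoc)
    have c: "1\<^sub>m 2 + Q * (N * S) \<in> carrier_mat 2 2" using Q NS by auto
    have f: "(1\<^sub>m 2 + Q * (N * S)) $$ (a,b) = (if a = b then 1 else 0) + (Q * (N * S)) $$ (a,b)"
      if "a < 2" "b < 2" for a b
      using that carrier_matD[OF Q] carrier_matD[OF NS] by simp
    have "(Q * (N * S)) $$ (0,0) = - q v v" "(Q * (N * S)) $$ (0,1) = q v w"
      "(Q * (N * S)) $$ (1,0) = - q w v" "(Q * (N * S)) $$ (1,1) = q w w"
      unfolding q by (subst e; simp add: S_def Q_def sum_negf)+
    then show ?thesis unfolding det_2x2[OF c] by (simp add: f)
  qed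
  finally show ?thesis .
qed

section \<open>Few sample points that control a space of functions\<close>

lemma continuous_on_coordinate: "continuous_on S (\<lambda>x :: nat \<Rightarrow> real. x i)"
  by (rule continuous_on_subset[OF continuous_on_product_coordinates]) simp

lemma compact_PiE_UNIV:
  fixes S :: "'i \<Rightarrow> 'a::topological_space set"
  assumes "\<And>i. compact (S i)" shows "compact (PiE UNIV S)"
  using assms compactin_PiE[of "\<lambda>_. euclidean" UNIV S] by (simp add: euclidean_product_topology)

lemma compact_sequences_in:
  assumes "compact (U :: (nat \<Rightarrow> real) set)"
  shows "compact {X :: nat \<Rightarrow> nat \<Rightarrow> real. \<forall>i. X i \<in> U}"
proof -
  have "{X :: nat \<Rightarrow> nat \<Rightarrow> real. \<forall>i. X i \<in> U} = PiE UNIV (\<lambda>_. U)" by auto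
  then show ?thesis using compact_PiE_UNIV[of "\<lambda>_. U"] assms by simp
qed

lemma closed_regularized_sampling:
  "closed {X :: nat \<Rightarrow> nat \<Rightarrow> real. \<forall>c. \<forall>u\<in>U. (\<Sum>j<D. c j * u j)\<^sup>2 \<le> \<eta> * (\<Sum>j<D. (c j)\<^sup>2) + (\<Sum>i<m. (\<Sum>j<D. c j * X i j)\<^sup>2)}"
proof -
  have c: "continuous_on UNIV (\<lambda>X :: nat \<Rightarrow> nat \<Rightarrow> real. X i j)" for i j
    by (rule continuous_on_product_then_coordinatewise) simp
  have "closed (\<Inter>c. \<Inter>u\<in>U. {X :: nat \<Rightarrow> nat \<Rightarrow> real. (\<Sum>j<D. c j * u j)\<^sup>2 \<le> \<eta> * (\<Sum>j<D. (c j)\<^sup>2) + (\<Sum>i<m. (\<Sum>j<D. c j * X i j)\<^sup>2)})"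
    by (intro closed_INT ballI closed_Collect_le continuous_intros c)
  also have "(\<Inter>c. \<Inter>u\<in>U. {X :: nat \<Rightarrow> nat \<Rightarrow> real. (\<Sum>j<D. c j * u j)\<^sup>2 \<le> \<eta> * (\<Sum>j<D. (c j)\<^sup>2) + (\<Sum>i<m. (\<Sum>j<D. c j * X i j)\<^sup>2)})
    = {X. \<forall>c. \<forall>u\<in>U. (\<Sum>j<D. c j * u j)\<^sup>2 \<le> \<eta> * (\<Sum>j<D. (c j)\<^sup>2) + (\<Sum>i<m. (\<Sum>j<D. c j * X i j)\<^sup>2)}"
    by blast
  finally show ?thesis .
qed

text \<open>
  A tuple \<open>X\<close> of \<open>2 * D\<close> points is chosen to maximize the determinant of
  \<open>M = \<eta> I + \<Sum>i. X\<^sub>i X\<^sub>i\<^sup>T\<close>. Write \<open>q(u) = u\<^sup>T M\<^sup>-\<^sup>1 u\<close>. By maximality, exchanging \<open>X\<^sub>i\<close> for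
  \<open>u\<close> gives \<open>(1 - q(X\<^sub>i)) * (1 + q(u)) \<le> 1\<close>. The sum over \<open>i\<close>, where
  \<open>\<Sum>i. q(X\<^sub>i) \<le> D\<close> as a trace, gives \<open>D * (1 + q(u)) \<le> 2 * D\<close>, that is \<open>q(u) \<le> 1\<close>. By
  Cauchy-Schwarz, \<open>(c \<bullet> u)\<^sup>2 \<le> q(u) * c\<^sup>T M c\<close>, which is the claim. Taking twice as many points as
  the dimension is what makes the bound \<open>1\<close> rather than about \<open>D\<close>. The regularization by \<open>\<eta>\<close>
  makes \<open>M\<close> invertible even if \<open>U\<close> lies in a hyperplane.
\<close>

lemma regularized_sampling_inequality:
  fixes U :: "(nat \<Rightarrow> real) set"
  assumes U: "compact U" "U \<noteq> {}" and D: "D > 0" and \<eta>: "\<eta> > 0"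
  shows "\<exists>X. (\<forall>i. X i \<in> U) \<and> (\<forall>c. \<forall>u\<in>U.
    (\<Sum>j<D. c j * u j)\<^sup>2 \<le> \<eta> * (\<Sum>j<D. (c j)\<^sup>2) + (\<Sum>i<2*D. (\<Sum>j<D. c j * X i j)\<^sup>2))"
proof -
  define G :: "(nat \<Rightarrow> nat \<Rightarrow> real) \<Rightarrow> real mat" where
    "G X = mat D D (\<lambda>(j,l). (if j = l then \<eta> else 0) + (\<Sum>i<2*D. X i j * X i l))" for X
  define K where "K = {X :: nat \<Rightarrow> nat \<Rightarrow> real. \<forall>i. X i \<in> U}"
  have G: "G X \<in> carrier_mat D D" for X unfolding G_def by simp
  have coord: "continuous_on UNIV (\<lambda>X :: nat \<Rightarrow> nat \<Rightarrow> real. X i j)" for i j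
    by (rule continuous_on_product_then_coordinatewise) simp
  have "continuous_on UNIV (\<lambda>X. \<Sum>p\<in>{p. p permutes {0..<D}}. signof p *
      (\<Prod>j = 0..<D. (if j = p j then \<eta> else 0) + (\<Sum>i<2*D. X i j * X i (p j))))"
    by (intro continuous_intros coord)
  moreover have "det (G X) = (\<Sum>p\<in>{p. p permutes {0..<D}}. signof p *
      (\<Prod>j = 0..<D. (if j = p j then \<eta> else 0) + (\<Sum>i<2*D. X i j * X i (p j))))" for X
    unfolding det_def'[OF G]
    by (intro sum.cong refl arg_cong2[where f = "(*)"] prod.cong) (auto simp: G_def permutes_in_image)
  ultimately have "continuous_on UNIV (\<lambda>X. det (G X))" by presburger
  then have "continuous_on K (\<lambda>X. \<bar>det (G X)\<bar>)"
    by (intro continuous_on_rabs) (rule continuous_on_subset[OF _ subset_UNIV])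
  moreover have "compact K" unfolding K_def by (rule compact_sequences_in[OF U(1)])
  moreover have "K \<noteq> {}"
  proof -
    obtain u where "u \<in> U" using U(2) by blast
    then have "(\<lambda>_. u) \<in> K" unfolding K_def by simp
    then show ?thesis by blast
  qed
  ultimately have "\<exists>X\<in>K. \<forall>Y\<in>K. \<bar>det (G Y)\<bar> \<le> \<bar>det (G X)\<bar>"
    by (intro continuous_attains_sup)
  then obtain X where X: "X \<in> K" and max: "\<And>Y. Y \<in> K \<Longrightarrow> \<bar>det (G Y)\<bar> \<le> \<bar>det (G X)\<bar>"
    by blast
  define M where "M = G X"
  have M: "M \<in> carrier_mat D D" unfolding M_def by (rule G)
  define \<beta> where "\<beta> x y = \<eta> * (\<Sum>j<D. x j * y j) + (\<Sum>i<2*D. (\<Sum>j<D. x j * X i j) * (\<Sum>j<D. y j * X i j))"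
    for x y :: "nat \<Rightarrow> real"
  have \<beta>M: "(\<Sum>j<D. x j * (\<Sum>l<D. M $$ (j,l) * y l)) = \<beta> x y" for x y
  proof -
    have "(\<Sum>j<D. x j * (\<Sum>l<D. M $$ (j,l) * y l))
      = (\<Sum>j<D. \<Sum>l<D. (if j = l then \<eta> * x j * y l else 0)) + (\<Sum>j<D. \<Sum>l<D. \<Sum>i<2*D. (x j * X i j) * (y l * X i l))"
      unfolding M_def G_def sum.distrib[symmetric] sum_distrib_left
      by (intro sum.cong refl) (auto simp: algebra_simps sum_distrib_left)
    also have "(\<Sum>j<D. \<Sum>l<D. \<Sum>i<2*D. (x j * X i j) * (y l * X i l)) =
      (\<Sum>j<D. \<Sum>i<2*D. \<Sum>l<D. (x j * X i j) * (y l * X i l))"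
      by (intro sum.cong refl sum.swap)
    also have "\<dots> = (\<Sum>i<2*D. (\<Sum>j<D. x j * X i j) * (\<Sum>l<D. y l * X i l))"
      unfolding sum_product by (rule sum.swap)
    finally show ?thesis unfolding \<beta>_def by (simp add: sum_distrib_left mult.assoc)
  qed
  have \<beta>sym: "\<beta> x y = \<beta> y x" for x y unfolding \<beta>_def by (simp add: mult.commute)
  have \<beta>nn: "\<beta> x x \<ge> \<eta> * (\<Sum>j<D. (x j)\<^sup>2)" for x
    unfolding \<beta>_def by (simp add: power2_eq_square[symmetric] sum_nonneg)
  have \<beta>pos: "\<beta> x x \<ge> 0" for x
    using \<beta>nn[of x] \<eta> by (smt (verit) mult_nonneg_nonneg sum_nonneg zero_le_power2)
  have \<beta>lin: "\<beta> (\<lambda>j. x j - s * y j) z = \<beta> x z - s * \<beta> y z" for x y z s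
  proof -
    have L: "(\<Sum>j<m. (a j - s * b j) * w j) = (\<Sum>j<m. a j * w j) - s * (\<Sum>j<m. b j * w j)"
      for m and a b w :: "nat \<Rightarrow> real"
      by (simp add: left_diff_distrib sum_subtractf sum_distrib_left mult.assoc)
    show ?thesis unfolding \<beta>_def L by (simp add: right_diff_distrib distrib_left mult.left_commute)
  qed
  have detM: "det M \<noteq> 0"
  proof
    assume "det M = 0"
    then obtain v where v: "v \<in> carrier_vec D" "v \<noteq> 0\<^sub>v D" "M *\<^sub>v v = 0\<^sub>v D"
      using det_0_iff_vec_prod_zero_field[OF M] by auto
    have "(\<Sum>l<D. M $$ (j,l) * vec_index v l) = 0" if "j < D" for j
    proof -
      have "(\<Sum>l<D. M $$ (j,l) * vec_index v l) = vec_index (M *\<^sub>v v) j"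
        using that M v(1) by (simp add: scalar_prod_def atLeast0LessThan)
      then show ?thesis using v(3) that by simp
    qed
    then have "\<beta> (vec_index v) (vec_index v) = 0" unfolding \<beta>M[symmetric] by simp
    then have "(\<Sum>j<D. (vec_index v j)\<^sup>2) \<le> 0" using \<beta>nn[of "vec_index v"] \<eta> by (simp add: mult_le_0_iff)
    then have "\<forall>j<D. vec_index v j = 0"
      using sum_nonneg_eq_0_iff[of "{..<D}" "\<lambda>j. (vec_index v j)\<^sup>2"] by (simp add: sum_nonneg order_antisym)
    then have "v = 0\<^sub>v D" using v(1) by (intro eq_vecI) auto
    then show False using v(2) by simp
  qed
  obtain N where N: "N \<in> carrier_mat D D" and MN: "M * N = 1\<^sub>m D" and NM: "N * M = 1\<^sub>m D"
    using det_non_zero_imp_unit[OF M detM, of "()"] unfolding Units_def ring_mat_simps by blast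
  have MNe: "(\<Sum>l<D. M $$ (j,l) * N $$ (l,k)) = (if j = k then 1 else 0)" if "j < D" "k < D" for j k
    using arg_cong[OF MN, of "\<lambda>A. A $$ (j,k)"] that M N by (simp add: scalar_prod_def atLeast0LessThan)
  have NMe: "(\<Sum>l<D. N $$ (j,l) * M $$ (l,k)) = (if j = k then 1 else 0)" if "j < D" "k < D" for j k
    using arg_cong[OF NM, of "\<lambda>A. A $$ (j,k)"] that M N by (simp add: scalar_prod_def atLeast0LessThan)
  define q where "q x y = (\<Sum>i<D. \<Sum>j<D. x i * N $$ (i,j) * y j)" for x y :: "nat \<Rightarrow> real"
  \<comment> \<open>multiplication by the inverse of M\<close>
  define n where "n u j = (\<Sum>l<D. N $$ (j,l) * u l)" for u :: "nat \<Rightarrow> real" and j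
  have Mn: "(\<Sum>l<D. M $$ (j,l) * n u l) = u j" if "j < D" for u j
  proof -
    have "(\<Sum>l<D. M $$ (j,l) * n u l) = (\<Sum>l<D. \<Sum>k<D. (M $$ (j,l) * N $$ (l,k)) * u k)"
      unfolding n_def sum_distrib_left by (simp add: mult.assoc)
    also have "\<dots> = (\<Sum>k<D. (\<Sum>l<D. M $$ (j,l) * N $$ (l,k)) * u k)"
      by (subst sum.swap) (simp add: sum_distrib_right)
    also have "\<dots> = (\<Sum>k<D. if k = j then u k else 0)"
      using that by (intro sum.cong refl) (simp add: MNe)
    finally show ?thesis using that by simp
  qed
  have \<beta>n: "\<beta> x (n u) = (\<Sum>j<D. x j * u j)" for x u
    unfolding \<beta>M[symmetric] by (intro sum.cong refl) (simp add: Mn)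
  have q\<beta>: "q x y = \<beta> (n x) (n y)" for x y
  proof -
    have "\<beta> (n x) (n y) = \<beta> (n y) (n x)" by (rule \<beta>sym)
    also have "\<dots> = q x y" unfolding \<beta>n q_def n_def by (simp add: sum_distrib_right sum_distrib_left mult_ac)
    finally show ?thesis by simp
  qed
  have trace: "(\<Sum>i<2*D. q (X i) (X i)) \<le> real D"
  proof -
    have Njj: "N $$ (j,j) \<ge> 0" if "j < D" for j
    proof -
      have "q (\<lambda>l. if l = j then 1 else 0) (\<lambda>l. if l = j then 1 else 0)
        = (\<Sum>i<D. \<Sum>l<D. if i = j then (if l = j then N $$ (i,l) else 0) else 0)"
        unfolding q_def by (intro sum.cong refl) auto
      also have "\<dots> = (\<Sum>i<D. if i = j then N $$ (i,j) else 0)"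
        using that by (intro sum.cong refl) simp
      also have "\<dots> = N $$ (j,j)" using that by simp
      finally show ?thesis using q\<beta> \<beta>pos by metis
    qed
    have "(\<Sum>i<2*D. q (X i) (X i)) = (\<Sum>j<D. \<Sum>i<2*D. \<Sum>l<D. X i j * N $$ (j,l) * X i l)"
      unfolding q_def by (rule sum.swap)
    also have "\<dots> = (\<Sum>j<D. \<Sum>l<D. \<Sum>i<2*D. X i j * N $$ (j,l) * X i l)"
      by (intro sum.cong refl sum.swap)
    also have "\<dots> = (\<Sum>j<D. \<Sum>l<D. N $$ (j,l) * (\<Sum>i<2*D. X i l * X i j))"
      by (simp add: sum_distrib_left mult_ac)
    also have "\<dots> = (\<Sum>j<D. (\<Sum>l<D. N $$ (j,l) * M $$ (l,j)) - (\<Sum>l<D. if l = j then \<eta> * N $$ (j,l) else 0))"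
      unfolding sum_subtractf[symmetric] by (intro sum.cong refl) (auto simp: M_def G_def algebra_simps)
    also have "\<dots> = (\<Sum>j<D. 1 - \<eta> * N $$ (j,j))"
      by (intro sum.cong refl) (simp add: NMe)
    also have "\<dots> \<le> (\<Sum>j<D. 1)" using Njj \<eta> by (intro sum_mono) simp
    finally show ?thesis by simp
  qed
  have d1: "q u u \<le> 1" if u: "u \<in> U" for u
  proof -
    have ex: "(1 - q (X i) (X i)) * (1 + q u u) \<le> 1" if i: "i < 2 * D" for i
    proof -
      have "X(i := u) \<in> K" using X u unfolding K_def by simp
      moreover have "G (X(i := u)) = mat D D (\<lambda>(j,l). M $$ (j,l) + u j * u l - X i j * X i l)"
      proof -
        have "(\<Sum>k<2*D. (X(i := u)) k j * (X(i := u)) k l) = (\<Sum>k<2*D. X k j * X k l) + u j * u l - X i j * X i l" for j l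
          using i by (simp add: sum.remove[of "{..<2*D}" i])
        then show ?thesis unfolding M_def G_def by (intro eq_matI) auto
      qed
      ultimately have "\<bar>det M * ((1 - q (X i) (X i)) * (1 + q u u) + q (X i) u * q u (X i))\<bar> \<le> \<bar>det M\<bar>"
        using max[of "X(i := u)"] det_exchange[OF M N MN q_def, of u "X i"] by (simp add: M_def)
      then have "\<bar>(1 - q (X i) (X i)) * (1 + q u u) + q (X i) u * q u (X i)\<bar> \<le> 1"
        using detM by (simp add: abs_mult)
      moreover have "q (X i) u * q u (X i) \<ge> 0" using q\<beta> \<beta>sym by (metis zero_le_square)
      ultimately show ?thesis by linarith
    qed
    have "(\<Sum>i<2*D. (1 - q (X i) (X i)) * (1 + q u u)) \<le> (\<Sum>i<2*D. 1)"
      by (intro sum_mono ex) simp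
    then have a: "(2 * real D - (\<Sum>i<2*D. q (X i) (X i))) * (1 + q u u) \<le> 2 * real D"
      by (simp add: sum_distrib_right[symmetric] sum_subtractf)
    have p: "1 + q u u \<ge> 0" using q\<beta>[of u u] \<beta>pos[of "n u"] by simp
    have "real D * (1 + q u u) \<le> (2 * real D - (\<Sum>i<2*D. q (X i) (X i))) * (1 + q u u)"
      using trace p by (intro mult_right_mono) auto
    with a have "real D * (1 + q u u) \<le> real D * 2" by simp
    then show ?thesis using D by simp
  qed
  have "(\<Sum>j<D. c j * u j)\<^sup>2 \<le> \<eta> * (\<Sum>j<D. (c j)\<^sup>2) + (\<Sum>i<2*D. (\<Sum>j<D. c j * X i j)\<^sup>2)"
    if u: "u \<in> U" for c u
  proof -
    define s where "s = (\<Sum>j<D. c j * u j)"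
    \<comment> \<open>Cauchy-Schwarz for the inner product of M, applied to c and the M-inverse image of u\<close>
    have "0 \<le> \<beta> (\<lambda>j. c j - s * n u j) (\<lambda>j. c j - s * n u j)" by (rule \<beta>pos)
    also have "\<dots> = \<beta> c c - 2 * s * \<beta> c (n u) + s\<^sup>2 * \<beta> (n u) (n u)"
      unfolding \<beta>lin by (subst (1 2) \<beta>sym) (simp add: \<beta>lin \<beta>sym[of "n u" c] power2_eq_square algebra_simps)
    also have "\<dots> = \<beta> c c - 2 * s\<^sup>2 + s\<^sup>2 * q u u"
      unfolding \<beta>n[of c] s_def[symmetric] q\<beta> by (simp add: power2_eq_square)
    also have "\<dots> \<le> \<beta> c c - 2 * s\<^sup>2 + s\<^sup>2 * 1"
      using d1[OF u] by (intro add_left_mono mult_left_mono) auto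
    finally show ?thesis unfolding s_def \<beta>_def by (simp add: power2_eq_square)
  qed
  then have "\<forall>c. \<forall>u\<in>U. (\<Sum>j<D. c j * u j)\<^sup>2 \<le> \<eta> * (\<Sum>j<D. (c j)\<^sup>2) + (\<Sum>i<2*D. (\<Sum>j<D. c j * X i j)\<^sup>2)"
    by blast
  moreover have "\<forall>i. X i \<in> U" using X unfolding K_def by simp
  ultimately show ?thesis by (intro exI[of _ X] conjI)
qed

text \<open>
  The sets of good tuples for the various \<open>\<eta>\<close> are closed and nested in a compact space, so one
  tuple is good for all \<open>\<eta> > 0\<close> at once.
\<close>

lemma sampling_inequality_vec:
  fixes U :: "(nat \<Rightarrow> real) set"
  assumes U: "compact U" "U \<noteq> {}" and D: "D > 0"
  shows "\<exists>X. (\<forall>i. X i \<in> U) \<and> (\<forall>c. \<forall>u\<in>U.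
    (\<Sum>j<D. c j * u j)\<^sup>2 \<le> (\<Sum>i<2*D. (\<Sum>j<D. c j * X i j)\<^sup>2))"
proof -
  define L where "L c u = (\<Sum>j<D. c j * u j)\<^sup>2" for c u :: "nat \<Rightarrow> real"
  define R where "R X c = (\<Sum>i<2*D. (\<Sum>j<D. c j * X i j)\<^sup>2)" for X :: "nat \<Rightarrow> nat \<Rightarrow> real" and c :: "nat \<Rightarrow> real"
  define S where "S c = (\<Sum>j<D. (c j)\<^sup>2)" for c :: "nat \<Rightarrow> real"
  define F where "F \<eta> = {X. \<forall>c. \<forall>u\<in>U. L c u \<le> \<eta> * S c + R X c}" for \<eta> :: real
  define K where "K = {X :: nat \<Rightarrow> nat \<Rightarrow> real. \<forall>i. X i \<in> U}"
  have S: "S c \<ge> 0" for c unfolding S_def by (simp add: sum_nonneg)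
  have mono: "X \<in> F \<eta>'" if "\<eta> \<le> \<eta>'" "X \<in> F \<eta>" for \<eta> \<eta>' X
  proof -
    have "L c u \<le> \<eta>' * S c + R X c" if "u \<in> U" for c u
    proof -
      have "L c u \<le> \<eta> * S c + R X c" using \<open>X \<in> F \<eta>\<close> that unfolding F_def by blast
      moreover have "\<eta> * S c \<le> \<eta>' * S c" using \<open>\<eta> \<le> \<eta>'\<close> S by (rule mult_right_mono)
      ultimately show ?thesis by linarith
    qed
    then show ?thesis unfolding F_def by blast
  qed
  have "K \<inter> (\<Inter>\<eta>\<in>{0<..}. F \<eta>) \<noteq> {}"
  proof (rule compact_imp_fip_image)
    show "compact K" unfolding K_def by (rule compact_sequences_in[OF U(1)])
    show "closed (F \<eta>)" for \<eta> unfolding F_def L_def R_def S_def by (rule closed_regularized_sampling)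
    fix I :: "real set" assume I: "finite I" "I \<subseteq> {0<..}"
    define \<eta> where "\<eta> = Min (insert 1 I)"
    have "\<eta> \<in> insert 1 I" unfolding \<eta>_def using I(1) by (intro Min_in) auto
    then have \<eta>0: "\<eta> > 0" using I(2) by auto
    have \<eta>: "\<eta> \<le> \<eta>'" if "\<eta>' \<in> I" for \<eta>' unfolding \<eta>_def using I(1) that by simp
    obtain X where X: "\<forall>i. X i \<in> U" "\<forall>c. \<forall>u\<in>U. L c u \<le> \<eta> * S c + R X c"
      using regularized_sampling_inequality[OF U D \<eta>0] unfolding L_def R_def S_def by (elim exE conjE)
    then have "X \<in> K" "X \<in> F \<eta>" unfolding K_def F_def by blast+
    then have "X \<in> K \<inter> (\<Inter>\<eta>\<in>I. F \<eta>)" using mono \<eta> by blast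
    then show "K \<inter> (\<Inter>\<eta>\<in>I. F \<eta>) \<noteq> {}" by blast
  qed
  then obtain X where X: "X \<in> K \<inter> (\<Inter>\<eta>\<in>{0<..}. F \<eta>)" by blast
  then have XK: "X \<in> K" by blast
  have XF: "X \<in> F \<eta>" if "\<eta> > 0" for \<eta> using X that by blast
  have "L c u \<le> R X c" if "u \<in> U" for c u
  proof (rule field_le_epsilon)
    fix e :: real assume e: "e > 0"
    have "X \<in> F (e / (S c + 1))" using e S[of c] by (intro XF) simp
    then have "L c u \<le> e / (S c + 1) * S c + R X c" using that unfolding F_def by blast
    moreover have "e / (S c + 1) * S c \<le> e" using e S[of c] by (simp add: field_simps)
    ultimately show "L c u \<le> R X c + e" by linarith
  qed
  moreover have "\<forall>i. X i \<in> U" using XK unfolding K_def by simp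
  ultimately show ?thesis unfolding L_def R_def by blast
qed

text \<open>
  The vector version applies to the compact set of evaluation vectors \<open>(f\<^sub>i(x))\<^sub>i\<close>.
\<close>

lemma sampling_inequality:
  fixes f :: "'i \<Rightarrow> 'a::topological_space \<Rightarrow> real"
  assumes B: "compact B" "B \<noteq> {}" and I: "finite I" "I \<noteq> {}"
    and f: "\<And>i. i \<in> I \<Longrightarrow> continuous_on B (f i)"
  obtains b where "\<And>k. b k \<in> B"
    and "\<And>c x. x \<in> B \<Longrightarrow> (\<Sum>i\<in>I. c i * f i x)\<^sup>2 \<le> (\<Sum>k<2 * card I. (\<Sum>i\<in>I. c i * f i (b k))\<^sup>2)"
proof -
  define D where "D = card I"
  obtain e where e: "bij_betw e {..<D} I"
    using ex_bij_betw_nat_finite[OF I(1)] unfolding D_def atLeast0LessThan by blast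
  define u where "u x j = (if j < D then f (e j) x else 0)" for x j
  have "continuous_on B u"
  proof (rule continuous_on_coordinatewise_then_product)
    fix j show "continuous_on B (\<lambda>x. u x j)"
      using f[of "e j"] bij_betwE[OF e] unfolding u_def by (cases "j < D") simp_all
  qed
  then have "compact (u ` B)" using B(1) compact_continuous_image by blast
  moreover have "u ` B \<noteq> {}" using B(2) by simp
  moreover have "D > 0" unfolding D_def using I by (simp add: card_gt_0_iff)
  ultimately have "\<exists>X. (\<forall>i. X i \<in> u ` B) \<and> (\<forall>c. \<forall>v\<in>u ` B.
      (\<Sum>j<D. c j * v j)\<^sup>2 \<le> (\<Sum>i<2*D. (\<Sum>j<D. c j * X i j)\<^sup>2))"
    by (rule sampling_inequality_vec)
  then obtain X where X: "\<And>i. X i \<in> u ` B"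
    and le: "\<And>c v. v \<in> u ` B \<Longrightarrow> (\<Sum>j<D. c j * v j)\<^sup>2 \<le> (\<Sum>i<2*D. (\<Sum>j<D. c j * X i j)\<^sup>2)"
    by blast
  define b where "b k = (SOME x. x \<in> B \<and> X k = u x)" for k
  have b: "b k \<in> B" "X k = u (b k)" for k
  proof -
    have "\<exists>x. x \<in> B \<and> X k = u x" using X[of k] by blast
    then have "b k \<in> B \<and> X k = u (b k)" unfolding b_def by (rule someI_ex)
    then show "b k \<in> B" "X k = u (b k)" by auto
  qed
  have s: "(\<Sum>i\<in>I. c i * f i x) = (\<Sum>j<D. c (e j) * u x j)" for c x
    by (subst sum.reindex_bij_betw[OF e, symmetric]) (simp add: u_def)
  show ?thesis
  proof (rule that[OF b(1)])
    fix c x assume "x \<in> B"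
    then show "(\<Sum>i\<in>I. c i * f i x)\<^sup>2 \<le> (\<Sum>k<2 * card I. (\<Sum>i\<in>I. c i * f i (b k))\<^sup>2)"
      using le[of "u x" "\<lambda>j. c (e j)"] unfolding s D_def[symmetric] b(2) by simp
  qed
qed

section \<open>Symmetric convex bodies and their polars\<close>

definition dotp :: "nat \<Rightarrow> (nat \<Rightarrow> real) \<Rightarrow> (nat \<Rightarrow> real) \<Rightarrow> real" where
  "dotp n x y = (\<Sum>i<n. x i * y i)"

definition polar :: "nat \<Rightarrow> (nat \<Rightarrow> real) set \<Rightarrow> (nat \<Rightarrow> real) set" where
  "polar n C = {b \<in> topspace (Euclidean_space n). \<forall>x\<in>C. dotp n b x \<le> 1}"

lemma dotp_scale: "dotp n x (\<lambda>i. c * y i) = c * dotp n x y" "dotp n (\<lambda>i. c * x i) y = c * dotp n x y"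
  by (simp_all add: dotp_def sum_distrib_left mult_ac)

lemma dotp_diff: "dotp n x (\<lambda>i. y i - z i) = dotp n x y - dotp n x z"
  by (simp add: dotp_def right_diff_distrib sum_subtractf)

lemma convex_body_subset: "convex_body n C \<Longrightarrow> C \<subseteq> topspace (Euclidean_space n)"
  unfolding convex_body_def by (simp add: compactin_subset_topspace)

lemma convex_body_compact: "convex_body n C \<Longrightarrow> compact C"
  unfolding convex_body_def Euclidean_space_def
  by (simp add: compactin_subtopology euclidean_product_topology)

lemma convex_bodyD:
  "convex_body n C \<Longrightarrow> x \<in> C \<Longrightarrow> y \<in> C \<Longrightarrow> 0 \<le> u \<Longrightarrow> 0 \<le> v \<Longrightarrow> u + v = 1 \<Longrightarrow> (\<lambda>i. u * x i + v * y i) \<in> C"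
  unfolding convex_body_def by blast

text \<open>
  If \<open>z\<close> is an interior point then so is \<open>- z\<close>, and \<open>0\<close> is halfway between the two.
\<close>

lemma symmetric_body_contains_cube:
  assumes C: "convex_body n C" and sym: "origin_symmetric C"
  obtains r where "r > 0"
    and "\<And>x. x \<in> topspace (Euclidean_space n) \<Longrightarrow> (\<And>i. i < n \<Longrightarrow> \<bar>x i\<bar> < r) \<Longrightarrow> x \<in> C"
proof -
  obtain z T where T: "openin (Euclidean_space n) T" "z \<in> T" "T \<subseteq> C"
    using C unfolding convex_body_def interior_of_def by blast
  then obtain S where S: "openin (powertop_real UNIV) S" "T = S \<inter> {x. \<forall>i\<ge>n. x i = 0}"
    unfolding Euclidean_space_def openin_subtopology by blast
  then obtain Y where Y: "z \<in> PiE UNIV Y" "\<And>i. open (Y i)" "PiE UNIV Y \<subseteq> S"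
    using product_topology_open_contains_basis[OF S(1), of z] T(2) by auto
  have "\<exists>e>0. ball (z i) e \<subseteq> Y i" for i
    using Y(1,2) by (meson PiE_mem UNIV_I open_contains_ball)
  then obtain e where e: "\<And>i. e i > 0" "\<And>i. ball (z i) (e i) \<subseteq> Y i" by metis
  define r where "r = Min (insert 1 (e ` {..<n}))"
  have "r \<in> insert 1 (e ` {..<n})" unfolding r_def by (intro Min_in) auto
  then have r0: "r > 0" using e(1) by auto
  have re: "r \<le> e i" if "i < n" for i unfolding r_def using that by (intro Min_le) auto
  have zx: "(\<lambda>i. z i + x i) \<in> C"
    if x: "x \<in> topspace (Euclidean_space n)" "\<And>i. i < n \<Longrightarrow> \<bar>x i\<bar> < r" for x
  proof -
    have z0: "z i = 0" "x i = 0" if "i \<ge> n" for i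
      using T(2) S(2) x(1) that by (auto simp: topspace_Euclidean_space)
    have "z i + x i \<in> Y i" for i
    proof (cases "i < n")
      case True
      then have "z i + x i \<in> ball (z i) (e i)" using x(2)[OF True] re[OF True] by (simp add: dist_real_def)
      then show ?thesis using e(2) by blast
    next
      case False
      then show ?thesis using Y(1) z0[of i] by (metis PiE_mem UNIV_I add_0 not_less)
    qed
    then have "(\<lambda>i. z i + x i) \<in> S" using Y(3) by auto
    then show ?thesis using S(2) T(3) z0 by auto
  qed
  show ?thesis
  proof (rule that[OF r0])
    fix x assume x: "x \<in> topspace (Euclidean_space n)" "\<And>i. i < n \<Longrightarrow> \<bar>x i\<bar> < r"
    have zx': "(\<lambda>i. z i + - x i) \<in> C" using x by (intro zx) (auto simp: topspace_Euclidean_space)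
    have "(\<lambda>i. - (z i + - x i)) \<in> C"
      by (rule bspec[OF sym[unfolded origin_symmetric_def] zx'])
    from convex_bodyD[OF C zx[OF x] this, of "1/2" "1/2"]
    have "(\<lambda>i. 1 / 2 * (z i + x i) + 1 / 2 * - (z i + - x i)) \<in> C" by simp
    moreover have "(\<lambda>i. 1 / 2 * (z i + x i) + 1 / 2 * - (z i + - x i)) = x" by (auto simp: field_simps)
    ultimately show "x \<in> C" by (simp only:)
  qed
qed

text \<open>
  Testing against the points \<open>r / 2\<close> and \<open>- r / 2\<close> of the coordinate axes, which lie in \<open>C\<close>,
  puts the polar into a box.
\<close>

lemma compact_polar:
  assumes C: "convex_body n C" and sym: "origin_symmetric C"
  shows "compact (polar n C)"
proof -
  obtain r where r: "r > 0"
    and cube: "\<And>x. x \<in> topspace (Euclidean_space n) \<Longrightarrow> (\<And>i. i < n \<Longrightarrow> \<bar>x i\<bar> < r) \<Longrightarrow> x \<in> C"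
    using symmetric_body_contains_cube[OF C sym] by metis
  define S where "S i = (if i < n then {- 2 / r .. 2 / r} else {0})" for i
  have bound: "s * b i \<le> 2 / r" if "b \<in> polar n C" "i < n" "\<bar>s\<bar> = 1" for b i and s :: real
  proof -
    have "(\<lambda>j. if j = i then s * r / 2 else 0) \<in> C"
      using that r by (intro cube) (auto simp: topspace_Euclidean_space abs_mult)
    then have "dotp n b (\<lambda>j. if j = i then s * r / 2 else 0) \<le> 1" using that(1) unfolding polar_def by blast
    then show ?thesis using that(2) r by (simp add: dotp_def if_distrib cong: if_cong) (simp add: field_simps)
  qed
  have "b \<in> PiE UNIV S" if b: "b \<in> polar n C" for b
    using bound[OF b, of _ 1] bound[OF b, of _ "-1"] b unfolding S_def polar_def topspace_Euclidean_space
    by (auto simp: minus_le_iff not_less)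
  then have "polar n C = PiE UNIV S \<inter> (\<Inter>x\<in>C. {b. dotp n b x \<le> 1})"
    by (auto simp: polar_def topspace_Euclidean_space S_def PiE_iff not_less)
       (meson leD singletonD)
  moreover have "compact (PiE UNIV S)" by (rule compact_PiE_UNIV) (simp add: S_def)
  moreover have "closed (\<Inter>x\<in>C. {b. dotp n b x \<le> 1})"
    unfolding dotp_def by (intro closed_INT ballI closed_Collect_le continuous_intros continuous_on_coordinate)
  ultimately show ?thesis by (simp add: compact_Int_closed)
qed

lemma zero_in_polar: "(\<lambda>_. 0) \<in> polar n C"
  by (simp add: polar_def dotp_def topspace_Euclidean_space)

lemma polar_abs_le:
  assumes "origin_symmetric C" "b \<in> polar n C" "x \<in> C"
  shows "\<bar>dotp n b x\<bar> \<le> 1"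
proof -
  have "(\<lambda>i. - x i) \<in> C" using assms unfolding origin_symmetric_def by blast
  then have "dotp n b (\<lambda>i. - x i) \<le> 1" "dotp n b x \<le> 1" using assms unfolding polar_def by blast+
  moreover have "dotp n b (\<lambda>i. - x i) = - dotp n b x" using dotp_scale(1)[of n b "-1" x] by simp
  ultimately show ?thesis by linarith
qed

text \<open>
  A point \<open>x\<close> outside \<open>C\<close> is separated from \<open>C\<close> by the hyperplane orthogonal to \<open>a = x - y\<close>, where
  \<open>y\<close> is the point of \<open>C\<close> nearest to \<open>x\<close>. Dividing \<open>a\<close> by a level \<open>\<beta>\<close> strictly between
  \<open>a \<bullet> y \<ge> 0\<close> and \<open>a \<bullet> x\<close> gives a point of the polar that violates the hypothesis.
\<close>

lemma bipolar:
  assumes C: "convex_body n C" and C0: "(\<lambda>_. 0) \<in> C"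
    and x: "x \<in> topspace (Euclidean_space n)" and le: "\<And>b. b \<in> polar n C \<Longrightarrow> dotp n b x \<le> 1"
  shows "x \<in> C"
proof (rule ccontr)
  assume "x \<notin> C"
  define g where "g y = dotp n (\<lambda>i. x i - y i) (\<lambda>i. x i - y i)" for y
  have "continuous_on C g" unfolding g_def dotp_def by (intro continuous_intros continuous_on_coordinate)
  then obtain y where y: "y \<in> C" and min: "\<And>z. z \<in> C \<Longrightarrow> g y \<le> g z"
    using continuous_attains_inf[OF convex_body_compact[OF C], of g] C0 by blast
  define a where "a = (\<lambda>i. x i - y i)"
  have az: "dotp n a z \<le> dotp n a y" if z: "z \<in> C" for z
  proof -
    define u where "u = (\<lambda>i. z i - y i)"
    \<comment> \<open>first-order optimality of y along the segment from y to z\<close>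
    have t: "2 * dotp n a u \<le> 0 + t * dotp n u u" if t: "0 < t" "t \<le> 1" for t
    proof -
      have "(\<lambda>i. t * z i + (1 - t) * y i) \<in> C" using t by (intro convex_bodyD[OF C z y]) auto
      from min[OF this] have "dotp n a a \<le> dotp n (\<lambda>i. a i - t * u i) (\<lambda>i. a i - t * u i)"
        unfolding g_def a_def u_def by (simp add: algebra_simps)
      also have "\<dots> = dotp n a a - 2 * t * dotp n a u + t\<^sup>2 * dotp n u u"
        by (simp add: dotp_def sum_distrib_left sum_subtractf[symmetric] sum.distrib[symmetric] power2_eq_square algebra_simps)
      finally have "t * (2 * dotp n a u) \<le> t * (t * dotp n u u)" by (simp add: power2_eq_square algebra_simps)
      then show ?thesis using t by simp
    qed
    have "2 * dotp n a u \<le> 0"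
    proof (rule field_le_epsilon)
      fix e :: real assume e: "e > 0"
      have u0: "dotp n u u \<ge> 0" unfolding dotp_def by (intro sum_nonneg) simp
      define t where "t = min 1 (e / (dotp n u u + 1))"
      have "t * dotp n u u \<le> e / (dotp n u u + 1) * dotp n u u" unfolding t_def using u0 by (intro mult_right_mono) auto
      also have "\<dots> \<le> e" using e u0 by (simp add: field_simps)
      finally show "2 * dotp n a u \<le> 0 + e" using t[of t] e u0 by (simp add: t_def)
    qed
    then show ?thesis unfolding u_def dotp_diff by simp
  qed
  have "dotp n a a > 0"
  proof -
    obtain i where i: "x i \<noteq> y i" using \<open>x \<notin> C\<close> y by (metis ext)
    have "i < n" using i x convex_body_subset[OF C] y by (fastforce simp: topspace_Euclidean_space not_less[symmetric])
    then show ?thesis unfolding dotp_def a_def using i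
      by (intro sum_pos2[of _ i]) (auto simp: zero_less_mult_iff)
  qed
  then have ax: "dotp n a y < dotp n a x" using dotp_diff[of n a x y] unfolding a_def by simp
  have ay: "0 \<le> dotp n a y" using az[OF C0] by (simp add: dotp_def)
  define \<beta> where "\<beta> = (dotp n a x + dotp n a y) / 2"
  have \<beta>: "\<beta> > 0" "dotp n a y < \<beta>" "\<beta> < dotp n a x" unfolding \<beta>_def using ax ay by auto
  have "(\<lambda>i. 1 / \<beta> * a i) \<in> polar n C"
  proof -
    have "(\<lambda>i. 1 / \<beta> * a i) \<in> topspace (Euclidean_space n)"
      using x y convex_body_subset[OF C] unfolding a_def by (auto simp: topspace_Euclidean_space)
    moreover have "dotp n (\<lambda>i. 1 / \<beta> * a i) z \<le> 1" if "z \<in> C" for z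
      unfolding dotp_scale using az[OF that] \<beta> by (simp add: field_simps)
    ultimately show ?thesis unfolding polar_def by blast
  qed
  from le[OF this] show False unfolding dotp_scale using \<beta> by (simp add: field_simps)
qed

section \<open>Polynomial functions of bounded degree\<close>

text \<open>
  The monomials of degree at most \<open>k\<close> in \<open>n\<close> variables are indexed by the lists of \<open>n + 1\<close>
  exponents with sum exactly \<open>k\<close>; the last entry belongs to a homogenizing variable, which
  \<open>monomial\<close> sets to \<open>1\<close>.
\<close>

definition exponents :: "nat \<Rightarrow> nat \<Rightarrow> nat list set" where
  "exponents n k = {l. length l = Suc n \<and> sum_list l = k}"

definition monomial :: "nat \<Rightarrow> nat list \<Rightarrow> (nat \<Rightarrow> real) \<Rightarrow> real" where
  "monomial n l b = (\<Prod>i<n. b i ^ (l ! i))"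

definition poly_fun :: "nat \<Rightarrow> nat \<Rightarrow> ((nat \<Rightarrow> real) \<Rightarrow> real) \<Rightarrow> bool" where
  "poly_fun n k g \<longleftrightarrow> (\<exists>c. \<forall>b. g b = (\<Sum>l\<in>exponents n k. c l * monomial n l b))"

lemma card_exponents: "card (exponents n k) = (n + k) choose k"
  using card_length_sum_list[of "Suc n" k] by (simp add: exponents_def add.commute)

lemma finite_exponents: "finite (exponents n k)"
  by (rule card_ge_0_finite) (simp add: card_exponents)

lemma poly_fun_add: "poly_fun n k g \<Longrightarrow> poly_fun n k h \<Longrightarrow> poly_fun n k (\<lambda>b. g b + h b)"
proof (unfold poly_fun_def, elim exE)
  fix c d assume "\<forall>b. g b = (\<Sum>l\<in>exponents n k. c l * monomial n l b)" "\<forall>b. h b = (\<Sum>l\<in>exponents n k. d l * monomial n l b)"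
  then show "\<exists>c. \<forall>b. g b + h b = (\<Sum>l\<in>exponents n k. c l * monomial n l b)"
    by (intro exI[of _ "\<lambda>l. c l + d l"]) (simp add: distrib_right sum.distrib)
qed

lemma poly_fun_cmult: "poly_fun n k g \<Longrightarrow> poly_fun n k (\<lambda>b. a * g b)"
proof (unfold poly_fun_def, elim exE)
  fix c assume "\<forall>b. g b = (\<Sum>l\<in>exponents n k. c l * monomial n l b)"
  then show "\<exists>c. \<forall>b. a * g b = (\<Sum>l\<in>exponents n k. c l * monomial n l b)"
    by (intro exI[of _ "\<lambda>l. a * c l"]) (simp add: sum_distrib_left mult.assoc)
qed

lemma poly_fun_sum:
  assumes "finite A" "\<And>i. i \<in> A \<Longrightarrow> poly_fun n k (g i)"
  shows "poly_fun n k (\<lambda>b. \<Sum>i\<in>A. g i b)"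
  using assms
proof (induction A rule: finite_induct)
  case empty
  then show ?case by (auto simp: poly_fun_def intro: exI[of _ "\<lambda>_. 0"])
qed (auto intro: poly_fun_add)

lemma poly_fun_monomial: "l \<in> exponents n k \<Longrightarrow> poly_fun n k (monomial n l)"
  unfolding poly_fun_def
  by (intro exI[of _ "\<lambda>l'. if l' = l then 1 else 0"]) (simp add: finite_exponents if_distrib if_distribR cong: if_cong)

text \<open>
  The index \<open>i = n\<close> stands for the homogenizing variable; it shows that a polynomial of degree at
  most \<open>k\<close> is one of degree at most \<open>k + 1\<close>.
\<close>

lemma poly_fun_raise:
  assumes "poly_fun n k g" and "i \<le> n"
  shows "poly_fun n (Suc k) (\<lambda>b. (if i < n then b i else 1) * g b)"
proof -
  obtain c where c: "\<And>b. g b = (\<Sum>l\<in>exponents n k. c l * monomial n l b)"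
    using assms(1) unfolding poly_fun_def by blast
  have "poly_fun n (Suc k) (\<lambda>b. \<Sum>l\<in>exponents n k. c l * monomial n (l[i := Suc (l ! i)]) b)"
  proof (intro poly_fun_sum finite_exponents poly_fun_cmult poly_fun_monomial)
    fix l assume "l \<in> exponents n k"
    then show "l[i := Suc (l ! i)] \<in> exponents n (Suc k)"
      using assms(2) by (auto simp: exponents_def sum_list_update)
  qed
  moreover have "monomial n (l[i := Suc (l ! i)]) b = (if i < n then b i else 1) * monomial n l b"
    if "l \<in> exponents n k" for l b
  proof (cases "i < n")
    case True
    have len: "length l = Suc n" using that by (simp add: exponents_def)
    have "(\<Prod>j\<in>{..<n} - {i}. b j ^ (l[i := Suc (l ! i)] ! j)) = (\<Prod>j\<in>{..<n} - {i}. b j ^ (l ! j))"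
      by (intro prod.cong refl) auto
    then show ?thesis using True len
      by (simp add: monomial_def prod.remove[of "{..<n}" i] mult.assoc)
  next
    case False
    then have "i = n" using assms(2) by simp
    then show ?thesis by (simp add: monomial_def)
  qed
  ultimately show ?thesis unfolding c
    by (simp add: sum_distrib_left mult.left_commute cong: sum.cong)
qed

lemma poly_fun_mono:
  assumes "poly_fun n j g" "j \<le> k" shows "poly_fun n k g"
  using assms(2,1) by (induction rule: dec_induct) (use poly_fun_raise[of n _ g n] in auto)

lemma poly_fun_power_dotp: "poly_fun n k (\<lambda>b. dotp n b x ^ k)"
proof (induction k)
  case 0
  have "replicate (Suc n) 0 \<in> exponents n 0" by (simp add: exponents_def)
  from poly_fun_monomial[OF this] show ?case by (simp add: monomial_def[abs_def] del: replicate_Suc)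
next
  case (Suc k)
  have "poly_fun n (Suc k) (\<lambda>b. \<Sum>i\<in>{..<n}. x i * ((if i < n then b i else 1) * dotp n b x ^ k))"
    using Suc by (intro poly_fun_sum poly_fun_cmult poly_fun_raise) auto
  moreover have "(\<Sum>i\<in>{..<n}. x i * ((if i < n then b i else 1) * dotp n b x ^ k)) = dotp n b x ^ Suc k" for b
    by (simp add: dotp_def[of n b x] sum_distrib_right mult_ac)
  ultimately show ?case by simp
qed

lemma poly_fun_poly_dotp:
  assumes "degree p \<le> k"
  shows "poly_fun n k (\<lambda>b. poly p (dotp n b x))"
  unfolding poly_altdef
  using assms by (intro poly_fun_sum poly_fun_cmult poly_fun_mono[OF poly_fun_power_dotp]) auto

section \<open>Choice of the degree\<close>

text \<open>
  The induction step is \<open>(1 + 1 / n) ^ n \<le> e\<close>. The bound \<open>e ^ n\<close> would be easier, but the factor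
  \<open>1 / e\<close> gained here pays for the doubling of the number of points, also in small dimensions.
\<close>

lemma power_self_le_fact_exp:
  assumes "n > 0" shows "real n ^ n \<le> fact n * exp (real n - 1)"
  using assms
proof (induction n rule: nat_induct_non_zero)
  case (Suc n)
  have "(1 + 1 / real n) ^ n \<le> exp (1 / real n) ^ n"
    using Suc.hyps by (intro power_mono exp_ge_add_one_self) auto
  also have "\<dots> = exp 1" using Suc.hyps by (simp add: exp_of_nat_mult[symmetric])
  finally have "(1 + 1 / real n) ^ n * real n ^ n \<le> exp 1 * (fact n * exp (real n - 1))"
    using Suc.IH by (intro mult_mono) auto
  moreover have "(1 + 1 / real n) ^ n * real n ^ n = real (Suc n) ^ n"
    using Suc.hyps by (simp add: power_mult_distrib[symmetric] field_simps)
  moreover have "exp 1 * exp (real n - 1) = exp (real (Suc n) - 1)" by (simp add: exp_add[symmetric])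
  ultimately have "real (Suc n) ^ n \<le> fact n * exp (real (Suc n) - 1)" by (simp add: mult_ac)
  then have "real (Suc n) * real (Suc n) ^ n \<le> real (Suc n) * (fact n * exp (real (Suc n) - 1))"
    by (intro mult_left_mono) auto
  then show ?case by (simp add: algebra_simps)
qed simp

lemma binomial_bound:
  fixes a :: real
  assumes n: "n > 0" and a: "real (n + k) \<le> real n * a"
  shows "real ((n + k) choose k) \<le> (exp 1 * a) ^ n / exp 1"
proof -
  have a0: "a \<ge> 0" using a n by (smt (verit, best) mult_pos_neg of_nat_0_less_iff of_nat_0_le_iff)
  have "((n + k) choose k) * fact n \<le> (n + k) ^ n"
    using binomial_fact_pow[of "n + k" n] by (simp add: binomial_symmetric[of k "n + k"])
  then have "real ((n + k) choose k) * fact n \<le> real (n + k) ^ n"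
    by (metis of_nat_fact of_nat_le_iff of_nat_mult of_nat_power)
  also have "\<dots> \<le> (real n * a) ^ n" using a by (intro power_mono) auto
  also have "\<dots> = real n ^ n * a ^ n" by (rule power_mult_distrib)
  also have "\<dots> \<le> (fact n * exp (real n - 1)) * a ^ n"
    using power_self_le_fact_exp[OF n] a0 by (intro mult_right_mono) auto
  finally have "real ((n + k) choose k) * fact n \<le> (exp (real n - 1) * a ^ n) * fact n" by (simp add: mult_ac)
  then have "real ((n + k) choose k) \<le> exp (real n - 1) * a ^ n" by simp
  also have "exp (real n - 1) = exp 1 ^ n / exp 1" by (simp add: exp_diff exp_of_nat_mult[symmetric])
  finally show ?thesis by (simp add: power_mult_distrib)
qed

text \<open>
  The second inequality needs \<open>2 * k * ln (1 + s) \<ge> n * ln X + ln 4\<close> with \<open>s = sqrt (2 * \<epsilon>)\<close>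
  and \<open>X\<close> the base of the bound, so \<open>k\<close> is taken as \<open>n * a\<close> rounded up, where
  \<open>a\<close> is about \<open>ln X / (2 * s)\<close>. The first one then follows from \<open>e * (a + 2) \<le> X\<close> and \<open>X \<ge> 5\<close>. As \<open>\<epsilon>\<close>
  tends to \<open>0\<close>, \<open>ln X\<close> is about \<open>ln (1 / \<epsilon>) / 2\<close>, and the left side is asymptotically
  \<open>e / (2 * sqrt 2) < 1\<close> times the right one. Neither requirement on \<open>\<epsilon>\<close> involves \<open>n\<close>.
\<close>

lemma degree_choice:
  obtains \<epsilon>\<^sub>0 :: real where "\<epsilon>\<^sub>0 > 0"
    and "\<And>\<epsilon> n. 0 < \<epsilon> \<Longrightarrow> \<epsilon> < \<epsilon>\<^sub>0 \<Longrightarrow> n > 0 \<Longrightarrow>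
      \<exists>k. 2 * real ((n + k) choose k) \<le> (1 / (2 * sqrt \<epsilon>) * ln (1 / \<epsilon>)) ^ n - 1 \<and>
          (1 / (2 * sqrt \<epsilon>) * ln (1 / \<epsilon>)) ^ n \<le> ((1 + sqrt (2 * \<epsilon>)) ^ k / 2)\<^sup>2"
proof -
  define X where "X \<epsilon> = 1 / (2 * sqrt \<epsilon>) * ln (1 / \<epsilon>)" for \<epsilon> :: real
  \<comment> \<open>a rational lower bound for s * (1 - s), from 1.41 \<le> sqrt 2 \<le> 2\<close>
  define w where "w \<epsilon> = 141 / 100 * sqrt \<epsilon> * (1 - 2 * sqrt \<epsilon>)" for \<epsilon> :: real
  define a where "a \<epsilon> = (ln (X \<epsilon>) + 2) / (2 * w \<epsilon>)" for \<epsilon>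
  have "\<forall>\<^sub>F \<epsilon> in at_right 0. 272 / 100 * (a \<epsilon> + 2) \<le> X \<epsilon>"
    unfolding a_def X_def w_def by real_asymp
  moreover have "\<forall>\<^sub>F \<epsilon> in at_right 0. X \<epsilon> \<ge> 5" unfolding X_def by real_asymp
  moreover have "\<forall>\<^sub>F \<epsilon> in at_right (0::real). 2 * sqrt \<epsilon> < 1 / 2" by real_asymp
  ultimately have "\<forall>\<^sub>F \<epsilon> in at_right 0. 272 / 100 * (a \<epsilon> + 2) \<le> X \<epsilon> \<and> X \<epsilon> \<ge> 5 \<and> 2 * sqrt \<epsilon> < 1 / 2"
    by eventually_elim auto
  then obtain \<epsilon>\<^sub>0 :: real where \<epsilon>\<^sub>0: "\<epsilon>\<^sub>0 > 0" and
    ev: "\<And>\<epsilon>. 0 < \<epsilon> \<Longrightarrow> \<epsilon> < \<epsilon>\<^sub>0 \<Longrightarrow> 272 / 100 * (a \<epsilon> + 2) \<le> X \<epsilon> \<and> X \<epsilon> \<ge> 5 \<and> 2 * sqrt \<epsilon> < 1 / 2"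
    unfolding eventually_at_right_field by auto
  show ?thesis
  proof (rule that[OF \<epsilon>\<^sub>0], fold X_def)
    fix \<epsilon> :: real and n :: nat assume \<epsilon>: "0 < \<epsilon>" "\<epsilon> < \<epsilon>\<^sub>0" and n: "n > 0"
    have aX: "272 / 100 * (a \<epsilon> + 2) \<le> X \<epsilon>" and X5: "X \<epsilon> \<ge> 5" and r: "2 * sqrt \<epsilon> < 1 / 2"
      using ev[OF \<epsilon>] by auto
    have w: "w \<epsilon> > 0" unfolding w_def using r \<epsilon>(1) by simp
    have lnX: "ln (X \<epsilon>) > 0" using X5 by simp
    have a: "a \<epsilon> > 0" unfolding a_def using w lnX by simp
    define k where "k = nat \<lceil>real n * a \<epsilon>\<rceil>"
    have na: "real n * a \<epsilon> \<ge> 0" using a by simp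
    have k1: "real n * a \<epsilon> \<le> real k" unfolding k_def using na by linarith
    have "real k \<le> real n * a \<epsilon> + 1" unfolding k_def using na by linarith
    then have k2: "real (n + k) \<le> real n * (a \<epsilon> + 2)" using n by (simp add: algebra_simps)
    have "2 * real ((n + k) choose k) \<le> X \<epsilon> ^ n - 1"
    proof -
      have "exp 1 * (a \<epsilon> + 2) \<le> X \<epsilon>"
        using e_less_272 a aX by (smt (verit) mult_right_mono)
      then have "(exp 1 * (a \<epsilon> + 2)) ^ n \<le> X \<epsilon> ^ n" using a by (intro power_mono) auto
      then have "real ((n + k) choose k) \<le> X \<epsilon> ^ n / exp 1"
        using binomial_bound[OF n k2] by (smt (verit) divide_right_mono exp_gt_zero)
      also have "\<dots> \<le> X \<epsilon> ^ n / (5 / 2)"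
        using exp_lower_Taylor_quadratic[of 1] X5 by (intro divide_left_mono) auto
      finally have "2 * real ((n + k) choose k) \<le> 4 / 5 * X \<epsilon> ^ n" by simp
      moreover have "X \<epsilon> ^ n \<ge> 5" using X5 n self_le_power[of "X \<epsilon>" n] by linarith
      ultimately show ?thesis by linarith
    qed
    moreover have "X \<epsilon> ^ n \<le> ((1 + sqrt (2 * \<epsilon>)) ^ k / 2)\<^sup>2"
    proof -
      define s where "s = sqrt (2 * \<epsilon>)"
      have "141 / 100 \<le> sqrt (2 :: real)" by (rule real_le_rsqrt) (simp add: power2_eq_square)
      then have s1: "141 / 100 * sqrt \<epsilon> \<le> s" unfolding s_def real_sqrt_mult using \<epsilon>(1) by (intro mult_right_mono) auto
      have "sqrt 2 \<le> (2 :: real)" by (rule real_le_lsqrt) auto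
      then have s2: "s \<le> 2 * sqrt \<epsilon>" unfolding s_def real_sqrt_mult using \<epsilon>(1) by (intro mult_right_mono) auto
      have s0: "0 \<le> s" "s \<le> 1/2" using s2 r \<epsilon>(1) unfolding s_def by auto
      have "w \<epsilon> \<le> s * (1 - s)" unfolding w_def using s1 s2 s0 r \<epsilon>(1) by (intro mult_mono) auto
      also have "\<dots> = s - s\<^sup>2" by (simp add: power2_eq_square algebra_simps)
      also have "\<dots> \<le> ln (1 + s)" using s0 by (intro ln_one_plus_pos_lower_bound) auto
      finally have wl: "w \<epsilon> \<le> ln (1 + s)" .
      have ln4: "ln (4 :: real) \<le> 2"
      proof -
        have "ln (4 :: real) = 2 * ln 2" using ln_realpow[of 2 2] by simp
        then show ?thesis using ln_2_less_1 by simp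
      qed
      have "real n * ln (X \<epsilon>) + ln 4 \<le> real n * (ln (X \<epsilon>) + 2)"
        using n ln4 by (simp add: algebra_simps)
      also have "\<dots> = (real n * a \<epsilon>) * (2 * w \<epsilon>)" unfolding a_def using w by simp
      also have "\<dots> \<le> real k * (2 * ln (1 + s))" using k1 wl w na by (intro mult_mono) auto
      finally have "real n * ln (X \<epsilon>) + ln 4 \<le> real k * (2 * ln (1 + s))" .
      then have "ln (X \<epsilon> ^ n * 4) \<le> ln (((1 + s) ^ k)\<^sup>2)"
        using X5 s0 by (simp add: ln_mult ln_realpow)
      then have "X \<epsilon> ^ n * 4 \<le> ((1 + s) ^ k)\<^sup>2" using X5 s0 by simp
      then show ?thesis unfolding s_def by (simp add: power_divide)
    qed
    ultimately show "\<exists>k. 2 * real ((n + k) choose k) \<le> X \<epsilon> ^ n - 1 \<and>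
      X \<epsilon> ^ n \<le> ((1 + sqrt (2 * \<epsilon>)) ^ k / 2)\<^sup>2" by blast
  qed
qed

section \<open>Polytopes and generalized ellipsoids\<close>

text \<open>
  A Chebyshev polynomial of a linear form magnifies a small excess: where the form exceeds
  \<open>1 + \<epsilon>\<close>, the polynomial exceeds the bound that the sampling inequality derives from its values
  at the \<open>a j\<close>, which are at most \<open>1\<close> in modulus.
\<close>

lemma polytope_approximation:
  fixes C :: "(nat \<Rightarrow> real) set"
  assumes C: "convex_body n C" and sym: "origin_symmetric C" and \<epsilon>: "\<epsilon> > 0"
    and k: "2 * real ((n + k) choose k) < ((1 + sqrt (2 * \<epsilon>)) ^ k / 2)\<^sup>2"
  obtains a where "\<And>j. a j \<in> polar n C"
    and "\<And>x b. (\<And>j. j < 2 * ((n + k) choose k) \<Longrightarrow> \<bar>dotp n (a j) x\<bar> \<le> 1) \<Longrightarrow>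
           b \<in> polar n C \<Longrightarrow> dotp n b x \<le> 1 + \<epsilon>"
proof -
  define D where "D = (n + k) choose k"
  have "exponents n k \<noteq> {}" using card_exponents[of n k] by (metis binomial_eq_0_iff card.empty le_add2 not_less)
  moreover have "continuous_on (polar n C) (monomial n l)" for l
    unfolding monomial_def by (intro continuous_intros continuous_on_coordinate)
  ultimately obtain a where a: "\<And>j. a j \<in> polar n C"
    and le: "\<And>c b. b \<in> polar n C \<Longrightarrow> (\<Sum>l\<in>exponents n k. c l * monomial n l b)\<^sup>2
      \<le> (\<Sum>j<2*D. (\<Sum>l\<in>exponents n k. c l * monomial n l (a j))\<^sup>2)"
    using sampling_inequality[of "polar n C" "exponents n k" "monomial n"]
      compact_polar[OF C sym] zero_in_polar[of n C] finite_exponents[of n k]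
    unfolding card_exponents D_def[symmetric] by blast
  show ?thesis
  proof (rule that[OF a], fold D_def)
    fix x b assume x: "\<And>j. j < 2 * D \<Longrightarrow> \<bar>dotp n (a j) x\<bar> \<le> 1" and b: "b \<in> polar n C"
    obtain c where c: "\<And>b. poly (cheb_poly k) (dotp n b x) = (\<Sum>l\<in>exponents n k. c l * monomial n l b)"
      using poly_fun_poly_dotp[OF degree_cheb_poly, of n k x] unfolding poly_fun_def by blast
    show "dotp n b x \<le> 1 + \<epsilon>"
    proof (rule ccontr)
      assume "\<not> dotp n b x \<le> 1 + \<epsilon>"
      then have "(1 + sqrt (2 * \<epsilon>)) ^ k / 2 \<le> poly (cheb_poly k) (dotp n b x)"
        using \<epsilon> by (intro poly_cheb_ge) auto
      then have "((1 + sqrt (2 * \<epsilon>)) ^ k / 2)\<^sup>2 \<le> (poly (cheb_poly k) (dotp n b x))\<^sup>2"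
        using \<epsilon> by (intro power_mono) auto
      also have "\<dots> \<le> (\<Sum>j<2*D. (poly (cheb_poly k) (dotp n (a j) x))\<^sup>2)"
        unfolding c by (rule le[OF b])
      also have "\<dots> \<le> (\<Sum>j<2*D. 1)"
        using x by (intro sum_mono) (simp add: abs_square_le_1 cheb_poly_abs_le_1)
      also have "\<dots> < ((1 + sqrt (2 * \<epsilon>)) ^ k / 2)\<^sup>2" using k unfolding D_def by simp
      finally show False by simp
    qed
  qed
qed

text \<open>
  Boundedness of \<open>E\<close> makes the common kernel trivial: a vector in it spans a line on which all
  quadratic forms vanish, and such a line would lie in \<open>E\<close>.
\<close>

lemma polytope_as_generalized_ellipsoid:
  fixes a :: "nat \<Rightarrow> nat \<Rightarrow> real" and m n :: nat
  defines "E \<equiv> {x \<in> topspace (Euclidean_space n). \<forall>l<m. \<bar>dotp n (a l) x\<bar> \<le> 1}"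
  assumes m: "m > 0" and bdd: "\<And>i. bounded ((\<lambda>x. x i) ` E)"
  shows "generalized_ellipsoid n (2 * m - 1) E"
proof -
  define P where "P i j = (\<Sum>l<m. Polynomial.smult (a l i * a l j) (fejer_poly m l))" for i j
  have q: "quad_form n (poly_mat_eval P t) x = (\<Sum>l<m. poly (fejer_poly m l) t * (dotp n (a l) x)\<^sup>2)" for t x
  proof -
    have "quad_form n (poly_mat_eval P t) x
      = (\<Sum>i<n. \<Sum>j<n. \<Sum>l<m. poly (fejer_poly m l) t * ((a l i * x i) * (a l j * x j)))"
      unfolding quad_form_def poly_mat_eval_def P_def
      by (simp add: poly_sum sum_distrib_left sum_distrib_right mult_ac)
    also have "\<dots> = (\<Sum>i<n. \<Sum>l<m. \<Sum>j<n. poly (fejer_poly m l) t * ((a l i * x i) * (a l j * x j)))"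
      by (intro sum.cong refl sum.swap)
    also have "\<dots> = (\<Sum>l<m. \<Sum>i<n. \<Sum>j<n. poly (fejer_poly m l) t * ((a l i * x i) * (a l j * x j)))"
      by (rule sum.swap)
    finally show ?thesis unfolding dotp_def power2_eq_square sum_product by (simp add: sum_distrib_left)
  qed
  have sym: "P i j = P j i" for i j unfolding P_def by (simp add: mult.commute)
  have deg: "degree (P i j) \<le> 2 * m - 1" for i j
    unfolding P_def
    by (intro degree_sum_le finite_lessThan order.trans[OF degree_smult_le] degree_fejer_poly)
  have nn: "quad_form n (poly_mat_eval P t) x \<ge> 0" if "t \<in> {-1..1}" for t x
    unfolding q using that by (intro sum_nonneg mult_nonneg_nonneg fejer_nonneg) auto
  have E: "E = {x \<in> topspace (Euclidean_space n). \<forall>t\<in>{-1..1}. quad_form n (poly_mat_eval P t) x \<le> 1}"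
  proof -
    have "(\<forall>l<m. \<bar>dotp n (a l) x\<bar> \<le> 1) \<longleftrightarrow> (\<forall>t\<in>{-1..1}. quad_form n (poly_mat_eval P t) x \<le> 1)" for x
    proof (intro iffI ballI allI impI)
      fix t :: real assume l: "\<forall>l<m. \<bar>dotp n (a l) x\<bar> \<le> 1" and t: "t \<in> {-1..1}"
      have "quad_form n (poly_mat_eval P t) x \<le> (\<Sum>l<m. poly (fejer_poly m l) t * 1)"
        unfolding q using l t by (intro sum_mono mult_left_mono fejer_nonneg) (auto simp: abs_square_le_1)
      then show "quad_form n (poly_mat_eval P t) x \<le> 1" using sum_fejer[OF m] by simp
    next
      fix l assume t: "\<forall>t\<in>{-1..1}. quad_form n (poly_mat_eval P t) x \<le> 1" and l: "l < m"
      define t where "t = cos (real (2 * l + 1) * pi / real (2 * m))"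
      have t1: "t \<in> {-1..1}" unfolding t_def by simp
      have "1 * (dotp n (a l) x)\<^sup>2 \<le> poly (fejer_poly m l) t * (dotp n (a l) x)\<^sup>2"
        unfolding t_def using fejer_node_ge_1[OF m] by (intro mult_right_mono) auto
      also have "\<dots> \<le> quad_form n (poly_mat_eval P t) x"
        unfolding q using l t1 by (intro member_le_sum mult_nonneg_nonneg fejer_nonneg) auto
      also have "\<dots> \<le> 1" using t t1 by blast
      finally show "\<bar>dotp n (a l) x\<bar> \<le> 1" by (simp add: abs_square_le_1)
    qed
    then show ?thesis unfolding E_def by blast
  qed
  have ker: "(\<Inter>t\<in>{-1..1}. mat_kernel n (poly_mat_eval P t)) = {\<lambda>i. 0}"
  proof (intro equalityI subsetI)
    fix x assume x: "x \<in> (\<Inter>t\<in>{-1..1::real}. mat_kernel n (poly_mat_eval P t))"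
    have "x \<in> mat_kernel n (poly_mat_eval P 0)" using x by (rule INT_D) simp
    then have x0: "x \<in> topspace (Euclidean_space n)" by (simp add: mat_kernel_def)
    have z: "quad_form n (poly_mat_eval P t) (\<lambda>i. c * x i) = 0" if "t \<in> {-1..1}" for t c
    proof -
      have "(\<Sum>j<n. poly_mat_eval P t i j * x j) = 0" if "i < n" for i
        using x \<open>t \<in> {-1..1}\<close> that by (auto simp: mat_kernel_def)
      then have "(\<Sum>i<n. c * x i * c * (\<Sum>j<n. poly_mat_eval P t i j * x j)) = 0" by simp
      then show ?thesis unfolding quad_form_def by (simp add: sum_distrib_left mult_ac)
    qed
    have cE: "(\<lambda>i. c * x i) \<in> E" for c
      unfolding E using x0 z by (auto simp: topspace_Euclidean_space)
    have "x i = 0" for i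
    proof (rule ccontr)
      assume i: "x i \<noteq> 0"
      obtain B where B: "\<forall>y\<in>(\<lambda>x. x i) ` E. norm y \<le> B" using bdd[of i] unfolding bounded_iff by blast
      have "\<bar>(\<bar>B\<bar> + 1) / x i * x i\<bar> \<le> B" using B cE[of "(\<bar>B\<bar> + 1) / x i"] by fastforce
      then show False using i by simp
    qed
    then show "x \<in> {\<lambda>i. 0}" by auto
  qed (auto simp: mat_kernel_def topspace_Euclidean_space)
  show ?thesis unfolding generalized_ellipsoid_def
    by (rule exI[of _ P]) (use sym deg nn ker E in auto)
qed

theorem theorem5p7:
  shows "\<exists>\<epsilon>\<^sub>0::real. \<epsilon>\<^sub>0 > 0 \<and>
    (\<forall>\<epsilon>::real. 0 < \<epsilon> \<and> \<epsilon> < \<epsilon>\<^sub>0 \<longrightarrow>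
      (\<forall>n::nat. n > 0 \<longrightarrow>
        (\<forall>C :: (nat \<Rightarrow> real) set. convex_body n C \<and> origin_symmetric C \<longrightarrow>
          (\<exists>(d::nat) E. generalized_ellipsoid n d E \<and>
             real d \<le> 2 * (1 / (2 * sqrt \<epsilon>) * ln (1 / \<epsilon>)) ^ n - 3 \<and>
             E \<subseteq> C \<and> C \<subseteq> dilate (1 + \<epsilon>) E))))"
proof -
  obtain \<epsilon>\<^sub>0 :: real where \<epsilon>\<^sub>0: "\<epsilon>\<^sub>0 > 0"
    and choice: "\<And>\<epsilon> n. 0 < \<epsilon> \<Longrightarrow> \<epsilon> < \<epsilon>\<^sub>0 \<Longrightarrow> n > 0 \<Longrightarrow>
      \<exists>k. 2 * real ((n + k) choose k) \<le> (1 / (2 * sqrt \<epsilon>) * ln (1 / \<epsilon>)) ^ n - 1 \<and>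
          (1 / (2 * sqrt \<epsilon>) * ln (1 / \<epsilon>)) ^ n \<le> ((1 + sqrt (2 * \<epsilon>)) ^ k / 2)\<^sup>2"
    by (rule degree_choice) blast
  show ?thesis
  proof (intro exI[of _ \<epsilon>\<^sub>0] conjI allI impI \<epsilon>\<^sub>0; elim conjE)
    fix \<epsilon> :: real and n :: nat and C :: "(nat \<Rightarrow> real) set"
    assume \<epsilon>: "0 < \<epsilon>" "\<epsilon> < \<epsilon>\<^sub>0" and n: "0 < n" and C: "convex_body n C" and sym: "origin_symmetric C"
    define \<tau> where "\<tau> = 1 + \<epsilon>"
    have \<tau>: "\<tau> > 0" unfolding \<tau>_def using \<epsilon>(1) by simp
    obtain k where k1: "2 * real ((n + k) choose k) \<le> (1 / (2 * sqrt \<epsilon>) * ln (1 / \<epsilon>)) ^ n - 1"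
      and k2: "(1 / (2 * sqrt \<epsilon>) * ln (1 / \<epsilon>)) ^ n \<le> ((1 + sqrt (2 * \<epsilon>)) ^ k / 2)\<^sup>2"
      using choice[OF \<epsilon> n] by blast
    define m where "m = 2 * ((n + k) choose k)"
    have m: "m > 0" unfolding m_def by simp
    obtain a where a: "\<And>j. a j \<in> polar n C"
      and approx: "\<And>x b. (\<And>j. j < m \<Longrightarrow> \<bar>dotp n (a j) x\<bar> \<le> 1) \<Longrightarrow> b \<in> polar n C \<Longrightarrow> dotp n b x \<le> \<tau>"
      using polytope_approximation[OF C sym \<epsilon>(1), of k] k1 k2 unfolding m_def \<tau>_def by (smt (verit))
    have C0: "(\<lambda>_. 0) \<in> C"
    proof -
      obtain r where "r > 0" "\<And>x. x \<in> topspace (Euclidean_space n) \<Longrightarrow> (\<And>i. i < n \<Longrightarrow> \<bar>x i\<bar> < r) \<Longrightarrow> x \<in> C"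
        using symmetric_body_contains_cube[OF C sym] by metis
      then show ?thesis by (simp add: topspace_Euclidean_space)
    qed
    \<comment> \<open>the approximating polytope is shrunk by \<open>\<tau>\<close> so that it fits inside C\<close>
    define E where "E = {x \<in> topspace (Euclidean_space n). \<forall>l<m. \<bar>dotp n (\<lambda>i. \<tau> * a l i) x\<bar> \<le> 1}"
    have EC: "E \<subseteq> C"
    proof
      fix x assume x: "x \<in> E"
      have "dotp n b (\<lambda>i. \<tau> * x i) \<le> \<tau>" if "b \<in> polar n C" for b
        using x that by (intro approx) (simp_all add: E_def dotp_scale)
      then have "dotp n b x \<le> 1" if "b \<in> polar n C" for b using that \<tau> by (simp add: dotp_scale)
      then show "x \<in> C" using bipolar[OF C C0, of x] x unfolding E_def by blast
    qed
    have "bounded ((\<lambda>x. x i) ` E)" for i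
    proof -
      have "compact ((\<lambda>x. x i) ` C)"
        by (intro compact_continuous_image continuous_on_coordinate convex_body_compact[OF C])
      then show ?thesis using EC bounded_subset compact_imp_bounded image_mono by metis
    qed
    then have "generalized_ellipsoid n (2 * m - 1) E"
      unfolding E_def by (intro polytope_as_generalized_ellipsoid m)
    moreover have "real (2 * m - 1) \<le> 2 * (1 / (2 * sqrt \<epsilon>) * ln (1 / \<epsilon>)) ^ n - 3"
    proof -
      have "real (2 * m - 1) = 2 * real m - 1" using m by simp
      then show ?thesis using k1 unfolding m_def by simp
    qed
    moreover have "C \<subseteq> dilate (1 + \<epsilon>) E"
    proof
      fix y assume y: "y \<in> C"
      have "dotp n (\<lambda>i. \<tau> * a l i) (\<lambda>i. 1 / \<tau> * y i) = dotp n (a l) y" for l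
        unfolding dotp_scale using \<tau> by simp
      moreover have "(\<lambda>i. 1 / \<tau> * y i) \<in> topspace (Euclidean_space n)"
        using y convex_body_subset[OF C] by (auto simp: topspace_Euclidean_space)
      ultimately have "(\<lambda>i. 1 / \<tau> * y i) \<in> E"
        using polar_abs_le[OF sym a y] unfolding E_def by simp
      moreover have "y = (\<lambda>i. (1 + \<epsilon>) * (1 / \<tau> * y i))" using \<tau> unfolding \<tau>_def by simp
      ultimately show "y \<in> dilate (1 + \<epsilon>) E" unfolding dilate_def by (intro CollectI exI conjI)
    qed
    ultimately show "\<exists>d E. generalized_ellipsoid n d E \<and> real d \<le> 2 * (1 / (2 * sqrt \<epsilon>) * ln (1 / \<epsilon>)) ^ n - 3 \<and>
        E \<subseteq> C \<and> C \<subseteq> dilate (1 + \<epsilon>) E" using EC by blast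
  qed
qed

end
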